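(* For every recursively enumerable set $B\subseteq\omega$ there is a universal machine $U_B$ such that the following two conditions are equivalent for every set (oracle) $A\subseteq\omega$: - $A$ has PA-complete degree and $A\ge_T B$. - There is a function $F\le_T A$ such that for all $n$ and for all $x\in\{0,1\}^n$, $F(n)\in\{0,1\}^n$ and $C_B(F(n))\ge C_B(x)$, where $C_B$ is the plain Kolmogorov complexity based on the universal machine $U_B$.
   Context: Fix an acceptable numbering $\varphi_0,\varphi_1,\dots$ of the partial recursive functions. A (plain) machine is a partial recursive function $V$ from $\{0,1\}^*$ to $\{0,1\}^*$; the plain complexity based on $V$ is $C_V(x)=\min\{|p|:V(p)=x\}$ ($=\infty$ if there is no such $p$). A machine $U$ is universal if for every machine $V$ there is a constant $c$ with $C_U(x)\le C_V(x)+c$ for all $x$. A total function $f:\omega\to\omega$ is diagonally nonrecursive (DNR) if $f(x)\neq\varphi_x(x)$ for every $x$ with $\varphi_x(x)$ defined. A set $A$ has PA-complete degree if $A$ computes a $\{0,1\}$-valued DNR function (equivalently, a DNR function with finite range). *)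

theory Defs
  imports Main "HOL-Library.Extended_Nat"
begin

datatype recf =
    Zero
  | Succ
  | Proj nat
  | Oracle
  | Comp recf "recf list"
  | PrimRec recf recf
  | Mu recf

text \<open>
  Kleene's schemes, where \<open>Oracle\<close> is the characteristic function of the oracle \<open>A\<close>. Terms carry no
  arity: a term applied to an argument list of unsuitable length is simply undefined.
  The strict \<open>those\<close> makes a composition undefined as soon as one of the inner functions is, and
  \<open>Mu f\<close> requires \<open>f\<close> to be defined at every value below the root.
\<close>

fun eval :: "nat set \<Rightarrow> recf \<Rightarrow> nat list \<Rightarrow> nat option" where
  "eval A Zero xs = Some 0"
| "eval A Succ xs = (case xs of [x] \<Rightarrow> Some (Suc x) | _ \<Rightarrow> None)"
| "eval A (Proj i) xs = (if i < length xs then Some (xs ! i) else None)"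
| "eval A Oracle xs = (case xs of [x] \<Rightarrow> Some (if x \<in> A then 1 else 0) | _ \<Rightarrow> None)"
| "eval A (Comp f gs) xs = Option.bind (those (map (\<lambda>g. eval A g xs) gs)) (eval A f)"
| "eval A (PrimRec f g) xs =
     (case xs of [] \<Rightarrow> None
      | n # ys \<Rightarrow> rec_nat (eval A f ys)
                   (\<lambda>k r. Option.bind r (\<lambda>v. eval A g (k # v # ys))) n)"
| "eval A (Mu f) xs =
     (if \<exists>n. eval A f (n # xs) = Some 0 \<and> (\<forall>m<n. eval A f (m # xs) \<noteq> None)
      then Some (LEAST n. eval A f (n # xs) = Some 0)
      else None)"

text \<open>Unrelativized computability is computability with the empty oracle.\<close>

definition partial_recursive1 :: "(nat \<rightharpoonup> nat) \<Rightarrow> bool" where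
  "partial_recursive1 f \<longleftrightarrow> (\<exists>r. \<forall>x. f x = eval {} r [x])"

definition partial_recursive2 :: "(nat \<Rightarrow> nat \<rightharpoonup> nat) \<Rightarrow> bool" where
  "partial_recursive2 f \<longleftrightarrow> (\<exists>r. \<forall>x y. f x y = eval {} r [x, y])"

definition recursive_in :: "nat set \<Rightarrow> (nat \<Rightarrow> nat) \<Rightarrow> bool" where
  "recursive_in A f \<longleftrightarrow> (\<exists>r. \<forall>x. eval A r [x] = Some (f x))"

definition turing_le :: "nat set \<Rightarrow> nat set \<Rightarrow> bool"  (infix \<open>\<le>\<^sub>T\<close> 50) where
  "B \<le>\<^sub>T A \<longleftrightarrow> recursive_in A (\<lambda>x. if x \<in> B then 1 else 0)"

definition recursively_enumerable :: "nat set \<Rightarrow> bool" where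
  "recursively_enumerable B \<longleftrightarrow> (\<exists>f. partial_recursive1 f \<and> B = dom f)"

text \<open>Rogers' notion: the enumeration theorem together with the parametrization (s-m-n) theorem.\<close>

definition acceptable_numbering :: "(nat \<Rightarrow> nat \<rightharpoonup> nat) \<Rightarrow> bool" where
  "acceptable_numbering \<phi> \<longleftrightarrow>
     partial_recursive2 \<phi> \<and>
     (\<forall>\<psi>. partial_recursive2 \<psi> \<longrightarrow> (\<exists>s. recursive_in {} s \<and> (\<forall>e. \<phi> (s e) = \<psi> e)))"

definition DNR :: "(nat \<Rightarrow> nat \<rightharpoonup> nat) \<Rightarrow> (nat \<Rightarrow> nat) \<Rightarrow> bool" where
  "DNR \<phi> f \<longleftrightarrow> (\<forall>x. \<phi> x x \<noteq> None \<longrightarrow> \<phi> x x \<noteq> Some (f x))"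

definition PA_complete :: "(nat \<Rightarrow> nat \<rightharpoonup> nat) \<Rightarrow> nat set \<Rightarrow> bool" where
  "PA_complete \<phi> A \<longleftrightarrow> (\<exists>f. recursive_in A f \<and> range f \<subseteq> {0, 1} \<and> DNR \<phi> f)"

text \<open>
  The length-lexicographic bijection between binary strings and natural numbers: the binary
  expansion of \<open>str_code \<sigma> + 1\<close> is \<open>1\<sigma>\<close>.
\<close>

definition str_code :: "bool list \<Rightarrow> nat" where
  "str_code \<sigma> = foldl (\<lambda>n b. 2 * n + (if b then 2 else 1)) 0 \<sigma>"

lemma str_code_Nil [simp]: "str_code [] = 0"
  by (simp add: str_code_def)

lemma str_code_snoc [simp]: "str_code (\<sigma> @ [b]) = 2 * str_code \<sigma> + (if b then 2 else 1)"
  by (simp add: str_code_def)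

lemma bij_str_code: "bij str_code"
proof (rule bijI)
  have "str_code \<sigma> = str_code \<tau> \<Longrightarrow> \<sigma> = \<tau>" for \<sigma> \<tau>
  proof (induction \<sigma> arbitrary: \<tau> rule: rev_induct)
    case Nil
    then show ?case by (cases \<tau> rule: rev_cases) (auto split: if_splits)
  next
    case (snoc b \<sigma>)
    then obtain \<tau>' c where \<tau>: "\<tau> = \<tau>' @ [c]"
      by (cases \<tau> rule: rev_cases) (auto split: if_splits)
    have eq: "2 * str_code \<sigma> + (if b then 2 else 1) = 2 * str_code \<tau>' + (if c then 2 else 1)"
      using snoc.prems \<tau> by simp
    then have "even (2 * str_code \<sigma> + (if b then 2 else 1)) =
        even (2 * str_code \<tau>' + (if c then 2 else 1))"
      by (simp only:)
    then have "b = c" by (simp split: if_splits)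
    with eq have "str_code \<sigma> = str_code \<tau>'" by simp
    with snoc.IH \<tau> \<open>b = c\<close> show ?case by simp
  qed
  then show "inj str_code" by (rule injI)
next
  have "\<exists>\<sigma>. n = str_code \<sigma>" for n
  proof (induction n rule: less_induct)
    case (less n)
    show ?case
    proof (cases "n = 0")
      case True
      then show ?thesis by (intro exI[of _ "[]"]) simp
    next
      case False
      then obtain m b where n: "n = 2 * m + (if b then 2 else 1)" and "m < n"
      proof (cases "even n")
        case True
        then have "n = 2 * (n div 2 - 1) + 2" "n div 2 - 1 < n"
          using False by presburger+
        with that[of "n div 2 - 1" True] show ?thesis by simp
      next
        case False
        then have "n = 2 * (n div 2) + 1" "n div 2 < n"
          by presburger+
        with that[of "n div 2" False] show ?thesis by simp
      qed
      with less.IH obtain \<sigma> where "m = str_code \<sigma>" by blast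
      with n show ?thesis by (intro exI[of _ "\<sigma> @ [b]"]) simp
    qed
  qed
  then show "surj str_code" by (auto simp: surj_def)
qed

definition machine :: "(bool list \<rightharpoonup> bool list) \<Rightarrow> bool" where
  "machine V \<longleftrightarrow> (\<exists>f. partial_recursive1 f \<and> (\<forall>p. map_option str_code (V p) = f (str_code p)))"

definition string_fun_recursive_in :: "nat set \<Rightarrow> (nat \<Rightarrow> bool list) \<Rightarrow> bool" where
  "string_fun_recursive_in A F \<longleftrightarrow> recursive_in A (\<lambda>n. str_code (F n))"

definition plain_complexity :: "(bool list \<rightharpoonup> bool list) \<Rightarrow> bool list \<Rightarrow> enat" where
  "plain_complexity V x = Inf {enat (length p) | p. V p = Some x}"

definition universal_machine :: "(bool list \<rightharpoonup> bool list) \<Rightarrow> bool" where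
  "universal_machine U \<longleftrightarrow> machine U \<and>
     (\<forall>V. machine V \<longrightarrow>
        (\<exists>c. \<forall>x. plain_complexity U x \<le> plain_complexity V x + enat c))"

end

theory Submission
  imports Defs
begin

text \<open>
  The machine \<open>U\<close> describes every string by a program that is 3 bits longer, and simulates all other
  machines by programs so long that they describe fewer than half of the strings of length \<open>n\<close> by
  programs of length at most \<open>n + 2\<close>. The room in between is used to shorten the description of all
  strings of length \<open>n\<close> with a given last bit. If \<open>n = 2e + 1\<close>, this is done for the last bit
  \<open>\<phi>\<^sub>e(e)\<close>, so the last bit of a string of maximal complexity is a diagonally nonrecursive value.
  If \<open>n = 2e + 2\<close>, it is done for the last bit 1 and, if \<open>e\<close> enters \<open>B\<close>, even more for the last bit 0,
  so the last bit of a string of maximal complexity decides \<open>e \<in> B\<close>.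

  Conversely, \<open>B\<close> computes the maximal complexity of the strings of length \<open>n\<close>. The strings below it
  form a recursively enumerable set that omits a string of length \<open>n\<close>, and an oracle of PA-complete
  degree finds such a string by a knockout tournament in which a two-valued DNR function referees.
\<close>

section \<open>Closure properties of computable functions\<close>

text \<open>Terms carry no arity, so the arity is recorded as \<open>k\<close> and agreement is
  asked only on lists of that length. Functions can then be written as lambda terms over
  \<open>xs ! i\<close>.\<close>

definition partial_computable :: "nat set \<Rightarrow> nat \<Rightarrow> (nat list \<Rightarrow> nat option) \<Rightarrow> bool" where
  "partial_computable A k f \<longleftrightarrow> (\<exists>r. \<forall>xs. length xs = k \<longrightarrow> eval A r xs = f xs)"

definition computable :: "nat set \<Rightarrow> nat \<Rightarrow> (nat list \<Rightarrow> nat) \<Rightarrow> bool" where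
  "computable A k f \<longleftrightarrow> partial_computable A k (\<lambda>xs. Some (f xs))"

abbreviation decidable :: "nat set \<Rightarrow> nat \<Rightarrow> (nat list \<Rightarrow> bool) \<Rightarrow> bool" where
  "decidable A k P \<equiv> computable A k (\<lambda>xs. of_bool (P xs))"

section \<open>Composition and projections\<close>

lemma partial_computable_cong:
  "partial_computable A k f \<Longrightarrow> (\<And>xs. length xs = k \<Longrightarrow> f xs = g xs) \<Longrightarrow> partial_computable A k g"
  by (auto simp: partial_computable_def)

lemma computable_cong:
  "computable A k f \<Longrightarrow> (\<And>xs. length xs = k \<Longrightarrow> f xs = g xs) \<Longrightarrow> computable A k g"
  by (auto simp: computable_def intro: partial_computable_cong)

lemma those_map:
  "those (map h gs) = (if \<forall>g\<in>set gs. h g \<noteq> None then Some (map (the \<circ> h) gs) else None)"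
  by (induction gs) (auto split: option.splits)

text \<open>Only the outer function is partial: with total inner functions the strict
  \<open>those\<close> always succeeds.\<close>

lemma partial_computable_comp:
  assumes f: "partial_computable A (length hs) f"
    and hs: "\<And>h. h \<in> set hs \<Longrightarrow> computable A k h"
  shows "partial_computable A k (\<lambda>xs. f (map (\<lambda>h. h xs) hs))"
proof -
  obtain r where r: "\<And>xs. length xs = length hs \<Longrightarrow> eval A r xs = f xs"
    using f by (auto simp: partial_computable_def)
  have "\<forall>h\<in>set hs. \<exists>r. \<forall>xs. length xs = k \<longrightarrow> eval A r xs = Some (h xs)"
    using hs by (auto simp: computable_def partial_computable_def)
  then obtain R where R: "\<forall>h\<in>set hs. \<forall>xs. length xs = k \<longrightarrow> eval A (R h) xs = Some (h xs)"
    by metis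
  have "eval A (Comp r (map R hs)) xs = f (map (\<lambda>h. h xs) hs)" if "length xs = k" for xs
    using that R r by (auto simp: those_map o_def cong: map_cong)
  then show ?thesis
    unfolding partial_computable_def by blast
qed

lemma computable_comp:
  assumes "computable A (length hs) f" and "\<And>h. h \<in> set hs \<Longrightarrow> computable A k h"
  shows "computable A k (\<lambda>xs. f (map (\<lambda>h. h xs) hs))"
  using assms partial_computable_comp[of A hs "\<lambda>xs. Some (f xs)" k] by (auto simp: computable_def)

lemma partial_computable_comp2:
  assumes "partial_computable A 2 (\<lambda>xs. f (xs ! 0) (xs ! 1))" "computable A k g" "computable A k h"
  shows "partial_computable A k (\<lambda>xs. f (g xs) (h xs))"
  using partial_computable_comp[of A "[g, h]" "\<lambda>xs. f (xs ! 0) (xs ! 1)" k] assms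
  by (auto simp: numeral_2_eq_2)

lemma computable_comp1:
  assumes "computable A 1 (\<lambda>xs. f (xs ! 0))" "computable A k g"
  shows "computable A k (\<lambda>xs. f (g xs))"
  using computable_comp[of A "[g]" "\<lambda>xs. f (xs ! 0)" k] assms by auto

lemma computable_comp2:
  assumes "computable A 2 (\<lambda>xs. f (xs ! 0) (xs ! 1))" "computable A k g" "computable A k h"
  shows "computable A k (\<lambda>xs. f (g xs) (h xs))"
  using computable_comp[of A "[g, h]" "\<lambda>xs. f (xs ! 0) (xs ! 1)" k] assms
  by (auto simp: numeral_2_eq_2)

lemma computable_comp3:
  assumes "computable A 3 (\<lambda>xs. f (xs ! 0) (xs ! 1) (xs ! 2))"
    "computable A k g" "computable A k h" "computable A k i"
  shows "computable A k (\<lambda>xs. f (g xs) (h xs) (i xs))"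
  using computable_comp[of A "[g, h, i]" "\<lambda>xs. f (xs ! 0) (xs ! 1) (xs ! 2)" k] assms
  by (auto simp: numeral_3_eq_3 numeral_2_eq_2)

lemma computable_nth: "i < k \<Longrightarrow> computable A k (\<lambda>xs. xs ! i)"
  unfolding computable_def partial_computable_def by (rule exI[of _ "Proj i"]) auto

text \<open>Adding projections for the retained arguments turns this into ordinary composition. It
  serves where the number of arguments is a variable, as in the induction on terms.\<close>

lemma computable_comp_drop:
  assumes f: "computable A (length hs + k) f"
    and hs: "\<And>h. h \<in> set hs \<Longrightarrow> computable A (m + k) h"
  shows "computable A (m + k) (\<lambda>xs. f (map (\<lambda>h. h xs) hs @ drop m xs))"
proof (rule computable_cong)
  let ?hs = "hs @ map (\<lambda>i xs. xs ! (m + i)) [0..<k]"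
  show "computable A (m + k) (\<lambda>xs. f (map (\<lambda>h. h xs) ?hs))"
    by (rule computable_comp) (use f hs in \<open>auto intro: computable_nth\<close>)
  fix xs :: "nat list"
  assume "length xs = m + k"
  then have "map (\<lambda>h. h xs) (map (\<lambda>i xs. xs ! (m + i)) [0..<k]) = drop m xs"
    by (intro nth_equalityI) auto
  then show "f (map (\<lambda>h. h xs) ?hs) = f (map (\<lambda>h. h xs) hs @ drop m xs)"
    by (simp del: map_map)
qed

lemma computable_hd: "0 < k \<Longrightarrow> computable A k hd"
  by (rule computable_cong[OF computable_nth[of 0]]) (auto simp: hd_conv_nth)

section \<open>Basic functions and primitive recursion\<close>

lemma computable_Suc:
  assumes "computable A k f"
  shows "computable A k (\<lambda>xs. Suc (f xs))"
proof (rule computable_comp1[OF _ assms])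
  show "computable A 1 (\<lambda>xs. Suc (xs ! 0))"
    unfolding computable_def partial_computable_def
    by (rule exI[of _ Succ]) (auto simp: length_Suc_conv)
qed

lemma computable_const: "computable A k (\<lambda>_. c)"
proof (induction c)
  case 0
  show ?case unfolding computable_def partial_computable_def by (rule exI[of _ Zero]) auto
next
  case (Suc c)
  then show ?case by (rule computable_Suc)
qed

text \<open>\<open>PrimRec\<close> recurses on the head of its argument list. Putting the computed
  value \<open>n xs\<close> in front of \<open>xs\<close> gives recursion up to an arbitrary
  computable bound.\<close>

lemma computable_rec_nat:
  assumes b: "computable A k b" and g: "computable A (Suc (Suc k)) g" and n: "computable A k n"
  shows "computable A k (\<lambda>xs. rec_nat (b xs) (\<lambda>i v. g (i # v # xs)) (n xs))"
proof -
  obtain rb rg where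
    rb: "\<And>xs. length xs = k \<Longrightarrow> eval A rb xs = Some (b xs)" and
    rg: "\<And>xs. length xs = Suc (Suc k) \<Longrightarrow> eval A rg xs = Some (g xs)"
    using b g by (auto simp: computable_def partial_computable_def)
  let ?h = "\<lambda>xs. rec_nat (b (tl xs)) (\<lambda>i v. g (i # v # tl xs)) (hd xs)"
  have "eval A (PrimRec rb rg) (m # ys) = Some (?h (m # ys))" if "length ys = k" for m ys
    by (induction m) (use that rb rg in auto)
  then have h: "computable A (Suc k) ?h"
    unfolding computable_def partial_computable_def
    by (intro exI[of _ "PrimRec rb rg"]) (auto simp: length_Suc_conv simp del: eval.simps)
  show ?thesis
    using computable_comp_drop[of A "[n]" k ?h 0] h n by simp
qed

section \<open>Arithmetic\<close>

lemma computable_add: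
  assumes "computable A k f" "computable A k g"
  shows "computable A k (\<lambda>xs. f xs + g xs)"
proof (rule computable_cong)
  show "computable A k (\<lambda>xs. rec_nat (f xs) (\<lambda>i v. (\<lambda>ys. Suc (ys ! 1)) (i # v # xs)) (g xs))"
    by (intro computable_rec_nat computable_Suc computable_nth assms) auto
  have "rec_nat (f xs) (\<lambda>i v. Suc ((i # v # xs) ! 1)) n = f xs + n" for xs n
    by (induction n) auto
  then show "rec_nat (f xs) (\<lambda>i v. Suc ((i # v # xs) ! 1)) (g xs) = f xs + g xs" for xs .
qed

lemma computable_mult:
  assumes "computable A k f" "computable A k g"
  shows "computable A k (\<lambda>xs. f xs * g xs)"
proof (rule computable_comp2[OF _ assms], rule computable_cong)
  show "computable A 2 (\<lambda>xs. rec_nat 0 (\<lambda>i v. (\<lambda>ys. ys ! 1 + ys ! 2) (i # v # xs)) (xs ! 1))"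
    by (intro computable_rec_nat computable_add computable_nth computable_const) auto
  have "rec_nat 0 (\<lambda>i v. (i # v # xs) ! 1 + (i # v # xs) ! 2) n = xs ! 0 * n" for n and xs :: "nat list"
    by (induction n) auto
  then show "rec_nat 0 (\<lambda>i v. (i # v # xs) ! 1 + (i # v # xs) ! 2) (xs ! 1) = xs ! 0 * xs ! 1"
    for xs :: "nat list" .
qed

lemma computable_power:
  assumes "computable A k f" "computable A k g"
  shows "computable A k (\<lambda>xs. f xs ^ g xs)"
proof (rule computable_comp2[OF _ assms], rule computable_cong)
  show "computable A 2 (\<lambda>xs. rec_nat 1 (\<lambda>i v. (\<lambda>ys. ys ! 1 * ys ! 2) (i # v # xs)) (xs ! 1))"
    by (intro computable_rec_nat computable_mult computable_nth computable_const) auto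
  have "rec_nat 1 (\<lambda>i v. (i # v # xs) ! 1 * (i # v # xs) ! 2) n = (xs ! 0) ^ n"
    for n and xs :: "nat list"
    by (induction n) auto
  then show "rec_nat 1 (\<lambda>i v. (i # v # xs) ! 1 * (i # v # xs) ! 2) (xs ! 1) = (xs ! 0) ^ (xs ! 1)"
    for xs :: "nat list" .
qed

lemma computable_pred: 
  assumes "computable A k f"
  shows "computable A k (\<lambda>xs. f xs - 1)"
proof (rule computable_cong)
  show "computable A k (\<lambda>xs. rec_nat 0 (\<lambda>i v. (\<lambda>ys. ys ! 0) (i # v # xs)) (f xs))"
    by (intro computable_rec_nat computable_nth computable_const assms) auto
  show "rec_nat 0 (\<lambda>i v. (i # v # xs) ! 0) (f xs) = f xs - 1" for xs
    by (cases "f xs") auto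
qed

lemma computable_diff:
  assumes "computable A k f" "computable A k g"
  shows "computable A k (\<lambda>xs. f xs - g xs)"
proof (rule computable_cong)
  show "computable A k (\<lambda>xs. rec_nat (f xs) (\<lambda>i v. (\<lambda>ys. ys ! 1 - 1) (i # v # xs)) (g xs))"
    by (intro computable_rec_nat computable_pred computable_nth assms) auto
  have "rec_nat (f xs) (\<lambda>i v. (i # v # xs) ! 1 - 1) n = f xs - n" for xs n
    by (induction n) auto
  then show "rec_nat (f xs) (\<lambda>i v. (i # v # xs) ! 1 - 1) (g xs) = f xs - g xs" for xs .
qed

section \<open>Decidable predicates, definition by cases and search\<close>

lemma decidable_not:
  assumes "decidable A k P"
  shows "decidable A k (\<lambda>xs. \<not> P xs)"
  by (rule computable_cong[OF computable_diff[OF computable_const[of _ _ 1] assms]]) auto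

lemma decidable_conj:
  assumes "decidable A k P" "decidable A k Q"
  shows "decidable A k (\<lambda>xs. P xs \<and> Q xs)"
  by (rule computable_cong[OF computable_mult[OF assms]]) auto

lemma decidable_disj:
  assumes "decidable A k P" "decidable A k Q"
  shows "decidable A k (\<lambda>xs. P xs \<or> Q xs)"
  by (rule computable_cong[OF decidable_not[OF decidable_conj[OF assms[THEN decidable_not]]]]) auto

text \<open>With truncated subtraction, \<open>1 - (1 - (g - f))\<close> is 1 if
  \<open>f < g\<close> and 0 otherwise.\<close>

lemma decidable_less:
  assumes "computable A k f" "computable A k g"
  shows "decidable A k (\<lambda>xs. f xs < g xs)"
  by (rule computable_cong[OF computable_diff[OF computable_const[of _ _ 1]
          computable_diff[OF computable_const[of _ _ 1] computable_diff[OF assms(2,1)]]]]) auto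

lemma decidable_eq:
  assumes "computable A k f" "computable A k g"
  shows "decidable A k (\<lambda>xs. f xs = g xs)"
  by (rule computable_cong[OF decidable_conj[OF decidable_not[OF decidable_less[OF assms]]
          decidable_not[OF decidable_less[OF assms(2,1)]]]]) auto

lemma computable_if:
  assumes "decidable A k P" "computable A k f" "computable A k g"
  shows "computable A k (\<lambda>xs. if P xs then f xs else g xs)"
  by (rule computable_cong[OF computable_add[OF computable_mult[OF assms(1,2)]
          computable_mult[OF decidable_not[OF assms(1)] assms(3)]]]) auto

text \<open>\<open>Mu\<close> searches for a zero, so it is applied to the indicator of the negation
  of \<open>P\<close>. As that indicator is total, no undefined value can block the search.\<close>

lemma partial_computable_Least:
  assumes "decidable A (Suc k) P"
  shows "partial_computable A k
    (\<lambda>xs. if \<exists>n. P (n # xs) then Some (LEAST n. P (n # xs)) else None)"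
proof -
  obtain r where r: "\<And>xs. length xs = Suc k \<Longrightarrow> eval A r xs = Some (of_bool (\<not> P xs))"
    using decidable_not[OF assms] by (auto simp: computable_def partial_computable_def)
  then have "eval A (Mu r) xs = (if \<exists>n. P (n # xs) then Some (LEAST n. P (n # xs)) else None)"
    if "length xs = k" for xs
    using that by (simp add: of_bool_def)
  then show ?thesis
    unfolding partial_computable_def by blast
qed

lemma computable_Least:
  assumes P: "decidable A (Suc k) P"
    and ex: "\<And>xs. length xs = k \<Longrightarrow> \<exists>n. P (n # xs)"
  shows "computable A k (\<lambda>xs. LEAST n. P (n # xs))"
  unfolding computable_def
  by (rule partial_computable_cong[OF partial_computable_Least[OF P]]) (use ex in auto)

lemma computable_tl: "computable A k f \<Longrightarrow> computable A (Suc k) (\<lambda>xs. f (tl xs))"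
  using computable_comp_drop[of A "[]" k f 1] by (simp add: drop_Suc)

text \<open>The search is made total by letting it also stop at \<open>i = n xs\<close>. A witness
  below the bound exists exactly if it stops earlier.\<close>

lemma decidable_bex:
  assumes P: "decidable A (Suc k) P" and n: "computable A k n"
  shows "decidable A k (\<lambda>xs. \<exists>i<n xs. P (i # xs))"
proof -
  have "decidable A (Suc k) (\<lambda>ys. P ys \<or> ys ! 0 = n (tl ys))"
    by (intro decidable_disj decidable_eq P n computable_nth computable_tl) simp
  then have "computable A k (\<lambda>xs. LEAST i. P (i # xs) \<or> (i # xs) ! 0 = n (tl (i # xs)))"
    by (rule computable_Least) auto
  then have "decidable A k (\<lambda>xs. (LEAST i. P (i # xs) \<or> i = n xs) < n xs)"
    by (intro decidable_less n) simp
  then show ?thesis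
  proof (rule computable_cong)
    fix xs :: "nat list"
    let ?Q = "\<lambda>i. P (i # xs) \<or> i = n xs"
    have "(LEAST i. ?Q i) < n xs \<longleftrightarrow> (\<exists>i<n xs. P (i # xs))"
    proof
      have "?Q (LEAST i. ?Q i)"
        by (rule LeastI[of ?Q "n xs"]) simp
      then show "\<exists>i<n xs. P (i # xs)" if "(LEAST i. ?Q i) < n xs"
        using that by auto
    next
      assume "\<exists>i<n xs. P (i # xs)"
      then obtain i where i: "i < n xs" "P (i # xs)" by blast
      then have "(LEAST i. ?Q i) \<le> i" by (intro Least_le) simp
      then show "(LEAST i. ?Q i) < n xs" using i(1) by simp
    qed
    then show "of_bool ((LEAST i. ?Q i) < n xs) = (of_bool (\<exists>i<n xs. P (i # xs)) :: nat)" by simp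
  qed
qed

text \<open>\<open>Comp Zero [Succ]\<close> is 0 on lists of length one and undefined otherwise,
  just like \<open>Oracle\<close> for the empty set. So a term meant for the empty oracle can be
  rewritten to run with any oracle.\<close>

fun without_oracle :: "recf \<Rightarrow> recf" where
  "without_oracle Oracle = Comp Zero [Succ]"
| "without_oracle (Comp f gs) = Comp (without_oracle f) (map without_oracle gs)"
| "without_oracle (PrimRec f g) = PrimRec (without_oracle f) (without_oracle g)"
| "without_oracle (Mu f) = Mu (without_oracle f)"
| "without_oracle r = r"

lemma eval_without_oracle: "eval A (without_oracle r) xs = eval {} r xs"
proof (induction r arbitrary: xs)
  case Oracle
  then show ?case by (auto split: list.splits)
next
  case (Comp f gs)
  then have "map (\<lambda>g. eval A g xs) (map without_oracle gs) = map (\<lambda>g. eval {} g xs) gs"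
    by simp
  moreover have "eval A (without_oracle f) = eval {} f"
    using Comp.IH(1) by blast
  ultimately show ?case by (simp del: map_map)
next
  case (PrimRec f g)
  then show ?case by (simp split: list.splits)
qed simp_all

lemma partial_computable_relativize:
  "partial_computable {} k f \<Longrightarrow> partial_computable A k f"
  unfolding partial_computable_def by (metis eval_without_oracle)

lemma computable_relativize: "computable {} k f \<Longrightarrow> computable A k f"
  unfolding computable_def by (rule partial_computable_relativize)

section \<open>Division, parity, and total functions applied to partial ones\<close>

lemma computable_div:
  assumes "computable A k f" "computable A k g"
  shows "computable A k (\<lambda>xs. f xs div g xs)"
proof (rule computable_comp2[OF _ assms], rule computable_cong)
  \<comment> \<open>The quotient is the least \<open>n\<close> with \<open>x < Suc n * y\<close>.
    The disjunct for divisor 0 stops the search at 0, the value of \<open>x div 0\<close>.\<close>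
  let ?P = "\<lambda>ys :: nat list. ys ! 1 < Suc (ys ! 0) * ys ! 2 \<or> ys ! 2 = 0"
  show "computable A 2 (\<lambda>xs. LEAST n. ?P (n # xs))"
  proof (rule computable_Least)
    show "decidable A (Suc 2) ?P"
      by (intro decidable_disj decidable_less decidable_eq computable_mult computable_Suc
          computable_nth computable_const) auto
    have "?P (xs ! 0 # xs)" for xs
      by (cases "xs ! 1") auto
    then show "\<exists>n. ?P (n # xs)" for xs ..
  qed
  show "(LEAST n. ?P (n # xs)) = xs ! 0 div xs ! 1" for xs
  proof (rule Least_equality)
    show "?P (xs ! 0 div xs ! 1 # xs)"
      using dividend_less_div_times[of "xs ! 1" "xs ! 0"] by (auto simp: add.commute)
    show "xs ! 0 div xs ! 1 \<le> n" if "?P (n # xs)" for n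
      using that by (auto simp: less_mult_imp_div_less less_Suc_eq_le[symmetric] simp del: mult_Suc)
  qed
qed

lemma computable_mod:
  assumes "computable A k f" "computable A k g"
  shows "computable A k (\<lambda>xs. f xs mod g xs)"
  unfolding modulo_nat_def
  by (intro computable_diff computable_mult computable_div assms)

lemma decidable_even:
  assumes "computable A k f"
  shows "decidable A k (\<lambda>xs. even (f xs))"
  unfolding even_iff_mod_2_eq_zero
  by (intro decidable_eq computable_mod computable_const assms)

lemma partial_computable_map_option:
  assumes f: "partial_computable A k f" and g: "computable A (Suc k) g"
  shows "partial_computable A k (\<lambda>xs. map_option (\<lambda>v. g (v # xs)) (f xs))"
proof -
  obtain rf rg where
    rf: "\<And>xs. length xs = k \<Longrightarrow> eval A rf xs = f xs" and
    rg: "\<And>xs. length xs = Suc k \<Longrightarrow> eval A rg xs = Some (g xs)"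
    using f g by (auto simp: computable_def partial_computable_def)
  have "eval A (Comp rg (rf # map Proj [0..<k])) xs = map_option (\<lambda>v. g (v # xs)) (f xs)"
    if "length xs = k" for xs
  proof -
    have "those (map (\<lambda>g. eval A g xs) (map Proj [0..<k])) = Some xs"
      using that by (auto simp: those_map o_def intro: nth_equalityI)
    then show ?thesis
      using that rf rg by (cases "f xs") (auto simp del: map_map)
  qed
  then show ?thesis
    unfolding partial_computable_def by blast
qed

section \<open>Evaluation in bounded time\<close>

text \<open>The bound \<open>s\<close> cuts off only the searches of \<open>Mu\<close>; the other
  schemes terminate once their parts do. A bounded search stops at the first root, at the first
  undefined value or at \<open>s\<close>, which gives an effective approximation to evaluation with
  the empty oracle.\<close>

fun eval_within :: "nat \<Rightarrow> recf \<Rightarrow> nat list \<Rightarrow> nat option" where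
  "eval_within s (Comp f gs) xs =
     Option.bind (those (map (\<lambda>g. eval_within s g xs) gs)) (eval_within s f)"
| "eval_within s (PrimRec f g) xs =
     (case xs of [] \<Rightarrow> None
      | n # ys \<Rightarrow> rec_nat (eval_within s f ys)
                   (\<lambda>k r. Option.bind r (\<lambda>v. eval_within s g (k # v # ys))) n)"
| "eval_within s (Mu f) xs =
     (let n = LEAST n. eval_within s f (n # xs) \<in> {None, Some 0} \<or> n = s
      in if eval_within s f (n # xs) = Some 0 then Some n else None)"
| "eval_within s r xs = eval {} r xs"

lemma those_map_mono:
  assumes "those (map h gs) = Some vs" and "\<And>g v. g \<in> set gs \<Longrightarrow> h g = Some v \<Longrightarrow> h' g = Some v"
  shows "those (map h' gs) = Some vs"
  using assms by (induction gs arbitrary: vs) (auto split: option.splits)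

text \<open>Freed of the minimum, a successful bounded search differs in form from an unbounded one,
  as described by \<open>eval_Mu\<close>, only by \<open>n \<le> s\<close>. The inductions on terms
  can then compare values pointwise.\<close>

lemma eval_within_Mu:
  "eval_within s (Mu f) xs = Some n \<longleftrightarrow>
     n \<le> s \<and> eval_within s f (n # xs) = Some 0 \<and>
     (\<forall>m<n. \<exists>v. eval_within s f (m # xs) = Some (Suc v))"
proof -
  let ?Q = "\<lambda>n. eval_within s f (n # xs) \<in> {None, Some 0} \<or> n = s"
  let ?n = "LEAST n. ?Q n"
  have Q: "?Q ?n" by (rule LeastI[of ?Q s]) simp
  have le: "?n \<le> m" if "?Q m" for m using that by (rule Least_le)
  show ?thesis
  proof
    assume "eval_within s (Mu f) xs = Some n"
    then have n: "n = ?n" "eval_within s f (n # xs) = Some 0"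
      by (auto simp: Let_def split: if_splits)
    have "\<exists>v. eval_within s f (m # xs) = Some (Suc v)" if "m < n" for m
    proof -
      have "\<not> ?Q m" using le[of m] that n(1) by (metis not_le)
      then obtain v where "eval_within s f (m # xs) = Some v" "v \<noteq> 0" by auto
      then show ?thesis by (metis not0_implies_Suc)
    qed
    then show "n \<le> s \<and> eval_within s f (n # xs) = Some 0 \<and>
        (\<forall>m<n. \<exists>v. eval_within s f (m # xs) = Some (Suc v))"
      using n le[of s] by simp
  next
    assume R: "n \<le> s \<and> eval_within s f (n # xs) = Some 0 \<and>
        (\<forall>m<n. \<exists>v. eval_within s f (m # xs) = Some (Suc v))"
    have "?n = n"
    proof (rule Least_equality)
      show "n \<le> m" if "?Q m" for m
        using that R by (cases "m < n") auto
    qed (use R in simp)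
    then show "eval_within s (Mu f) xs = Some n"
      using R by (simp add: Let_def)
  qed
qed

lemma eval_Mu:
  "eval A (Mu f) xs = Some n \<longleftrightarrow>
     eval A f (n # xs) = Some 0 \<and> (\<forall>m<n. \<exists>v. eval A f (m # xs) = Some (Suc v))"
proof
  assume L: "eval A (Mu f) xs = Some n"
  then obtain k where k: "eval A f (k # xs) = Some 0" "\<forall>m<k. eval A f (m # xs) \<noteq> None"
    and n: "n = (LEAST n. eval A f (n # xs) = Some 0)"
    unfolding eval.simps by (auto split: if_splits simp del: not_None_eq)
  then have "n \<le> k" by (simp add: Least_le)
  have "\<exists>v. eval A f (m # xs) = Some (Suc v)" if "m < n" for m
  proof -
    have "eval A f (m # xs) \<noteq> None" using k(2) that \<open>n \<le> k\<close> by auto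
    moreover have "eval A f (m # xs) \<noteq> Some 0" using not_less_Least that unfolding n by blast
    ultimately show ?thesis by (auto simp: gr0_conv_Suc)
  qed
  moreover have "eval A f (n # xs) = Some 0"
    unfolding n by (rule LeastI) (rule k(1))
  ultimately show "eval A f (n # xs) = Some 0 \<and> (\<forall>m<n. \<exists>v. eval A f (m # xs) = Some (Suc v))"
    by simp
next
  assume R: "eval A f (n # xs) = Some 0 \<and> (\<forall>m<n. \<exists>v. eval A f (m # xs) = Some (Suc v))"
  have "(LEAST n. eval A f (n # xs) = Some 0) = n"
  proof (rule Least_equality)
    show "n \<le> m" if "eval A f (m # xs) = Some 0" for m
      using that R by (cases "m < n") auto
  qed (use R in simp)
  moreover have "\<exists>n. eval A f (n # xs) = Some 0 \<and> (\<forall>m<n. eval A f (m # xs) \<noteq> None)"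
    using R by (intro exI[of _ n]) auto
  ultimately show "eval A (Mu f) xs = Some n"
    unfolding eval.simps by (simp only: if_True)
qed

lemma eval_within_mono:
  "eval_within s r xs = Some v \<Longrightarrow> s \<le> s' \<Longrightarrow> eval_within s' r xs = Some v"
proof (induction r arbitrary: xs v)
  case (Comp f gs)
  then obtain vs where vs: "those (map (\<lambda>g. eval_within s g xs) gs) = Some vs"
    "eval_within s f vs = Some v"
    by (auto simp: bind_eq_Some_conv)
  have "those (map (\<lambda>g. eval_within s' g xs) gs) = Some vs"
    by (rule those_map_mono[OF vs(1)]) (use Comp in blast)
  then show ?case using vs(2) Comp by simp
next
  case (PrimRec f g)
  then obtain n ys where xs: "xs = n # ys" by (cases xs) auto
  have "rec_nat (eval_within s f ys) (\<lambda>k r. Option.bind r (\<lambda>v. eval_within s g (k # v # ys))) n = Some v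
    \<Longrightarrow> rec_nat (eval_within s' f ys) (\<lambda>k r. Option.bind r (\<lambda>v. eval_within s' g (k # v # ys))) n = Some v"
    for v
  proof (induction n arbitrary: v)
    case 0
    then show ?case using PrimRec.IH(1) PrimRec.prems(2) by simp
  next
    case (Suc n)
    then show ?case using PrimRec.IH(2) PrimRec.prems(2) by (auto simp: bind_eq_Some_conv)
  qed
  then show ?case using PrimRec.prems xs by simp
next
  case (Mu f)
  have "\<exists>w. eval_within s' f (m # xs) = Some (Suc w)" if "m < v" for m
    using Mu.prems(1) Mu.IH[OF _ Mu.prems(2)] that unfolding eval_within_Mu by blast
  moreover have "v \<le> s'" "eval_within s' f (v # xs) = Some 0"
    using Mu.prems Mu.IH[OF _ Mu.prems(2)] unfolding eval_within_Mu by auto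
  ultimately show ?case
    unfolding eval_within_Mu by blast
qed simp_all

lemma eval_within_sound: "eval_within s r xs = Some v \<Longrightarrow> eval {} r xs = Some v"
proof (induction r arbitrary: xs v)
  case (Comp f gs)
  then obtain vs where vs: "those (map (\<lambda>g. eval_within s g xs) gs) = Some vs"
    "eval_within s f vs = Some v"
    by (auto simp: bind_eq_Some_conv)
  have "those (map (\<lambda>g. eval {} g xs) gs) = Some vs"
    by (rule those_map_mono[OF vs(1)]) (use Comp in blast)
  then show ?case using vs(2) Comp by simp
next
  case (PrimRec f g)
  then obtain n ys where xs: "xs = n # ys" by (cases xs) auto
  have "rec_nat (eval_within s f ys) (\<lambda>k r. Option.bind r (\<lambda>v. eval_within s g (k # v # ys))) n = Some v
    \<Longrightarrow> rec_nat (eval {} f ys) (\<lambda>k r. Option.bind r (\<lambda>v. eval {} g (k # v # ys))) n = Some v"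
    for v
    by (induction n arbitrary: v) (use PrimRec.IH in \<open>auto simp: bind_eq_Some_conv\<close>)
  then show ?case using PrimRec.prems xs by simp
next
  case (Mu f)
  have "\<exists>w. eval {} f (m # xs) = Some (Suc w)" if "m < v" for m
    using Mu.prems Mu.IH that unfolding eval_within_Mu by blast
  moreover have "eval {} f (v # xs) = Some 0"
    using Mu.prems Mu.IH unfolding eval_within_Mu by blast
  ultimately show ?case
    unfolding eval_Mu by blast
qed simp_all

text \<open>By monotonicity in the stage, finitely many converging computations share the maximum of
  their stages. This is applied to the values of a function below its root.\<close>

lemma eval_within_bounded:
  fixes n :: nat
  assumes "\<And>m. m < n \<Longrightarrow> \<exists>s v. eval_within s f (F m) = Some v \<and> P m v"
  shows "\<exists>s. \<forall>s'\<ge>s. \<forall>m<n. \<exists>v. eval_within s' f (F m) = Some v \<and> P m v"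
  using assms
proof (induction n)
  case (Suc n)
  obtain s1 where s1: "\<forall>s'\<ge>s1. \<forall>m<n. \<exists>v. eval_within s' f (F m) = Some v \<and> P m v"
    using Suc by (meson less_SucI)
  obtain s2 v where s2: "eval_within s2 f (F n) = Some v \<and> P n v"
    using Suc.prems by blast
  have "\<exists>v. eval_within s' f (F m) = Some v \<and> P m v" if "max s1 s2 \<le> s'" "m < Suc n" for s' m
  proof (cases "m < n")
    case True
    then show ?thesis using s1 that by simp
  next
    case False
    then have "m = n" using that by simp
    moreover have "eval_within s' f (F n) = Some v"
      by (rule eval_within_mono[of s2]) (use s2 that in auto)
    ultimately show ?thesis using s2 by blast
  qed
  then show ?case by blast
qed simp

text \<open>A converging evaluation depends on finitely many converging evaluations of its parts.
  The maximum of their bounds serves for all of them, by monotonicity.\<close>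

lemma eval_within_complete: "eval {} r xs = Some v \<Longrightarrow> \<exists>s. eval_within s r xs = Some v"
proof (induction r arbitrary: xs v)
  case (Comp f gs)
  then obtain vs where vs: "those (map (\<lambda>g. eval {} g xs) gs) = Some vs" "eval {} f vs = Some v"
    by (auto simp: bind_eq_Some_conv)
  have "\<exists>s. those (map (\<lambda>g. eval_within s g xs) gs) = Some vs"
    using Comp.IH(2) vs(1)
  proof (induction gs arbitrary: vs)
    case (Cons g gs)
    then obtain u us where u: "eval {} g xs = Some u" "those (map (\<lambda>g. eval {} g xs) gs) = Some us"
      "vs = u # us"
      by (auto split: option.splits)
    obtain s1 where s1: "eval_within s1 g xs = Some u"
      using Cons.prems(1)[of g] u by auto
    have "\<exists>s. those (map (\<lambda>g. eval_within s g xs) gs) = Some us"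
      by (rule Cons.IH) (use Cons.prems u in auto)
    then obtain s2 where s2: "those (map (\<lambda>g. eval_within s2 g xs) gs) = Some us" ..
    have "those (map (\<lambda>g. eval_within (max s1 s2) g xs) gs) = Some us"
      by (rule those_map_mono[OF s2]) (erule eval_within_mono, simp)
    moreover have "eval_within (max s1 s2) g xs = Some u"
      using s1 by (rule eval_within_mono) simp
    ultimately show ?case using u by (intro exI[of _ "max s1 s2"]) simp
  qed simp
  then obtain s1 where s1: "those (map (\<lambda>g. eval_within s1 g xs) gs) = Some vs" ..
  obtain s2 where s2: "eval_within s2 f vs = Some v"
    using Comp.IH(1) vs(2) by blast
  have "those (map (\<lambda>g. eval_within (max s1 s2) g xs) gs) = Some vs"
    by (rule those_map_mono[OF s1]) (erule eval_within_mono, simp)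
  moreover have "eval_within (max s1 s2) f vs = Some v"
    using s2 by (rule eval_within_mono) simp
  ultimately show ?case by (intro exI[of _ "max s1 s2"]) simp
next
  case (PrimRec f g)
  then obtain n ys where xs: "xs = n # ys" by (cases xs) auto
  let ?E = "\<lambda>s. eval_within s (PrimRec f g)"
  have "eval {} (PrimRec f g) (n # ys) = Some v \<Longrightarrow> \<exists>s. ?E s (n # ys) = Some v" for v
  proof (induction n arbitrary: v)
    case 0
    then show ?case using PrimRec.IH(1) by simp
  next
    case (Suc n)
    then obtain u where u: "eval {} (PrimRec f g) (n # ys) = Some u" "eval {} g (n # u # ys) = Some v"
      by (auto simp: bind_eq_Some_conv)
    obtain s1 where s1: "?E s1 (n # ys) = Some u" using Suc.IH u by blast
    obtain s2 where s2: "eval_within s2 g (n # u # ys) = Some v" using PrimRec.IH(2) u by blast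
    have "?E (max s1 s2) (n # ys) = Some u"
      using s1 by (rule eval_within_mono) simp
    moreover have "eval_within (max s1 s2) g (n # u # ys) = Some v"
      using s2 by (rule eval_within_mono) simp
    ultimately show ?case by (intro exI[of _ "max s1 s2"]) simp
  qed
  then show ?case using PrimRec.prems xs by blast
next
  case (Mu f)
  then have e: "eval {} f (v # xs) = Some 0" "\<forall>m<v. \<exists>u. eval {} f (m # xs) = Some (Suc u)"
    unfolding eval_Mu by auto
  obtain s1 where s1: "eval_within s1 f (v # xs) = Some 0"
    using Mu.IH e(1) by blast
  have "\<exists>s u. eval_within s f (m # xs) = Some u \<and> 0 < u" if "m < v" for m
    using Mu.IH e(2) that by blast
  then have "\<exists>s. \<forall>s'\<ge>s. \<forall>m<v. \<exists>u. eval_within s' f (m # xs) = Some u \<and> 0 < u"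
    by (rule eval_within_bounded)
  then obtain s2 where s2: "\<And>s' m. s2 \<le> s' \<Longrightarrow> m < v \<Longrightarrow> \<exists>u. eval_within s' f (m # xs) = Some u \<and> 0 < u"
    by blast
  \<comment> \<open>Besides the stages for the values, the bound includes \<open>v\<close>, since
    the search has to reach the root.\<close>
  let ?s = "max v (max s1 s2)"
  have "eval_within ?s f (v # xs) = Some 0"
    using s1 by (rule eval_within_mono) simp
  moreover have "\<exists>w. eval_within ?s f (m # xs) = Some (Suc w)" if m: "m < v" for m
  proof -
    have "s2 \<le> ?s" by simp
    from s2[OF this m] obtain u where "eval_within ?s f (m # xs) = Some u" "0 < u" by blast
    then show ?thesis by (simp add: gr0_conv_Suc)
  qed
  ultimately have "eval_within ?s (Mu f) xs = Some v"
    unfolding eval_within_Mu by simp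
  then show ?case ..
qed simp_all

section \<open>Computability of bounded evaluation\<close>

lemma decidable_ball_list:
  "(\<And>h. h \<in> set hs \<Longrightarrow> decidable A k (P h)) \<Longrightarrow> decidable A k (\<lambda>xs. \<forall>h\<in>set hs. P h xs)"
  by (induction hs) (auto intro: computable_const decidable_conj)

text \<open>Coding undefinedness by 0 makes bounded evaluation a total function on numbers.\<close>

definition option_code :: "nat option \<Rightarrow> nat" where
  "option_code z = (case z of None \<Rightarrow> 0 | Some v \<Rightarrow> Suc v)"

lemma option_code_simps [simp]:
  "option_code None = 0" "option_code (Some v) = Suc v"
  "option_code z = 0 \<longleftrightarrow> z = None" "option_code z = Suc v \<longleftrightarrow> z = Some v"
  by (auto simp: option_code_def split: option.splits)

text \<open>The term is fixed; the head of the list is the stage and the tail holds the arguments.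
  Induction on the term, for all arities at once, matches each scheme with a closure property, where
  the code 0 of undefinedness has to be passed on.\<close>

lemma computable_eval_within:
  "computable {} (Suc k) (\<lambda>ys. option_code (eval_within (hd ys) r (tl ys)))"
proof (induction r arbitrary: k)
  case Zero
  show ?case
    by (rule computable_cong[OF computable_const[of _ _ 1]]) simp
next
  case Succ
  show ?case
  proof (cases "k = 1")
    case True
    have "computable {} (Suc k) (\<lambda>ys. Suc (Suc (ys ! 1)))"
      by (intro computable_Suc computable_nth) (use True in simp)
    then show ?thesis
      by (rule computable_cong) (auto simp: True length_Suc_conv)
  next
    case False
    show ?thesis
      by (rule computable_cong[OF computable_const[of _ _ 0]])
        (use False in \<open>auto simp: length_Suc_conv split: list.splits\<close>)
  qed
next
  case (Proj i)
  show ?case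
  proof (cases "i < k")
    case True
    have "computable {} (Suc k) (\<lambda>ys. Suc (ys ! Suc i))"
      by (intro computable_Suc computable_nth) (use True in simp)
    then show ?thesis
      by (rule computable_cong) (use True in \<open>auto simp: nth_tl\<close>)
  next
    case False
    show ?thesis
      by (rule computable_cong[OF computable_const[of _ _ 0]]) (use False in auto)
  qed
next
  case Oracle
  show ?case
    by (cases "k = 1"; rule computable_cong[OF computable_const[of _ _ "if k = 1 then 1 else 0"]])
      (auto simp: length_Suc_conv split: list.splits)
next
  case (Comp f gs)
  let ?c = "\<lambda>r ys. option_code (eval_within (hd ys) r (tl ys))"
  let ?hs = "hd # map (\<lambda>g ys. ?c g ys - 1) gs"
  have f: "computable {} (length ?hs) (?c f)"
    using Comp.IH(1)[of "length gs"] by simp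
  have "computable {} (Suc k)
      (\<lambda>ys. if \<forall>g\<in>set gs. \<not> ?c g ys = 0 then ?c f (map (\<lambda>h. h ys) ?hs) else 0)"
    by (intro computable_if decidable_ball_list decidable_not decidable_eq computable_const
        Comp.IH(2) computable_comp[OF f])
      (auto intro: computable_hd computable_pred[unfolded One_nat_def] Comp.IH(2))
  then show ?case
  proof (rule computable_cong)
    fix ys :: "nat list"
    show "(if \<forall>g\<in>set gs. \<not> ?c g ys = 0 then ?c f (map (\<lambda>h. h ys) ?hs) else 0) = ?c (Comp f gs) ys"
    proof (cases "\<forall>g\<in>set gs. \<not> ?c g ys = 0")
      case True
      then have m: "map (\<lambda>g. ?c g ys - 1) gs = map (the \<circ> (\<lambda>g. eval_within (hd ys) g (tl ys))) gs"
        by (intro map_cong) auto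
      have "those (map (\<lambda>g. eval_within (hd ys) g (tl ys)) gs) = Some (map (\<lambda>g. ?c g ys - 1) gs)"
        unfolding those_map m using True by simp
      moreover have "map (\<lambda>h. h ys) ?hs = hd ys # map (\<lambda>g. ?c g ys - 1) gs"
        by simp
      ultimately show ?thesis
        by (simp only: if_P[OF True] eval_within.simps bind.bind_lunit list.sel)
    next
      case False
      then show ?thesis by (auto simp: those_map)
    qed
  qed
next
  case (PrimRec f g)
  show ?case
  proof (cases k)
    case 0
    show ?thesis
    proof (rule computable_cong[OF computable_const[of _ _ 0]])
      fix xs :: "nat list"
      assume "length xs = Suc k"
      then obtain s where "xs = [s]"
        using 0 by (auto simp: length_Suc_conv)
      then show "0 = option_code (eval_within (hd xs) (PrimRec f g) (tl xs))"
        by simp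
    qed
  next
    case (Suc j)
    let ?f = "\<lambda>ys. option_code (eval_within (hd ys) f (tl ys))"
    let ?g = "\<lambda>ys. option_code (eval_within (hd ys) g (tl ys))"
    have 1: "computable {} (2 + j) (\<lambda>xs. ?f (map (\<lambda>h. h xs) [hd] @ drop 2 xs))"
    proof (rule computable_comp_drop[of "{}" "[hd]" j ?f 2])
      show "computable {} (length [hd] + j) ?f"
        using PrimRec.IH(1)[of j] by simp
    qed (auto intro: computable_hd)
    \<comment> \<open>The step function sees the list \<open>i # v # s # n # zs\<close>. From it
      \<open>g\<close> receives the stage \<open>s\<close>, the counter \<open>i\<close>, the
      decoded value \<open>v - 1\<close> and then \<open>zs\<close>.\<close>
    let ?hs = "[\<lambda>xs. xs ! 2, \<lambda>xs. xs ! 0, \<lambda>xs. xs ! 1 - 1]"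
    let ?g' = "\<lambda>xs. ?g (map (\<lambda>h. h xs) ?hs @ drop 4 xs)"
    let ?G = "\<lambda>xs. if xs ! 1 = 0 then 0 else ?g' xs"
    have g': "computable {} (4 + j) ?g'"
    proof (rule computable_comp_drop[of "{}" ?hs j ?g 4])
      show "computable {} (length ?hs + j) ?g"
        using PrimRec.IH(2)[of "Suc (Suc j)"] by simp
      have "computable {} (4 + j) (\<lambda>xs. xs ! 1 - 1)"
        by (intro computable_pred computable_nth) simp
      then show "computable {} (4 + j) h" if "h \<in> set ?hs" for h
        using that by (auto intro: computable_nth)
    qed
    have "computable {} (4 + j) ?G"
      by (intro computable_if[OF _ computable_const g'] decidable_eq computable_const computable_nth) simp
    moreover have "4 + j = Suc (Suc (2 + j))"
      by simp
    ultimately have 2: "computable {} (Suc (Suc (2 + j))) ?G"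
      by (simp only:)
    have "computable {} (2 + j) (\<lambda>xs. rec_nat (?f (map (\<lambda>h. h xs) [hd] @ drop 2 xs))
        (\<lambda>i v. ?G (i # v # xs)) (xs ! 1))"
      by (rule computable_rec_nat[OF 1 2 computable_nth]) simp
    then have "computable {} (Suc k) (\<lambda>xs. rec_nat (?f (map (\<lambda>h. h xs) [hd] @ drop 2 xs))
        (\<lambda>i v. ?G (i # v # xs)) (xs ! 1))"
      by (simp add: Suc)
    then show ?thesis
    proof (rule computable_cong)
      fix xs :: "nat list"
      assume "length xs = Suc k"
      then obtain s n zs where xs: "xs = s # n # zs"
        by (auto simp: Suc length_Suc_conv)
      have "rec_nat (?f (map (\<lambda>h. h xs) [hd] @ drop 2 xs)) (\<lambda>i v. ?G (i # v # xs)) n =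
        option_code (rec_nat (eval_within s f zs)
                   (\<lambda>k r. Option.bind r (\<lambda>v. eval_within s g (k # v # zs))) n)" for n
      proof (induction n)
        case (Suc n)
        show ?case
          by (cases "rec_nat (eval_within s f zs) (\<lambda>k r. Option.bind r (\<lambda>v. eval_within s g (k # v # zs))) n")
            (simp_all only: nat.rec Suc, simp_all add: xs numeral_2_eq_2 numeral_eq_Suc)
      qed (simp add: xs)
      then show "rec_nat (?f (map (\<lambda>h. h xs) [hd] @ drop 2 xs)) (\<lambda>i v. ?G (i # v # xs)) (xs ! 1) =
          option_code (eval_within (hd xs) (PrimRec f g) (tl xs))"
        by (simp add: xs)
    qed
  qed
next
  case (Mu f)
  let ?f = "\<lambda>ys. option_code (eval_within (hd ys) f (tl ys))"
  \<comment> \<open>The list is \<open>n # s # zs\<close>, and \<open>f\<close> receives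
    \<open>s\<close>, \<open>n\<close> and \<open>zs\<close>. A code below 2 means undefined or
    zero.\<close>
  let ?P = "\<lambda>xs. ?f (map (\<lambda>h. h xs) [\<lambda>xs. xs ! 1, \<lambda>xs. xs ! 0] @ drop 2 xs) < 2 \<or> xs ! 0 = xs ! 1"
  have "computable {} (2 + k) (\<lambda>xs. ?f (map (\<lambda>h. h xs) [\<lambda>xs. xs ! 1, \<lambda>xs. xs ! 0] @ drop 2 xs))"
    by (rule computable_comp_drop) (use Mu.IH[of "Suc k"] in \<open>auto intro: computable_nth\<close>)
  then have "decidable {} (Suc (Suc k)) ?P"
    by (intro decidable_disj decidable_less decidable_eq computable_nth computable_const) auto
  then have L: "computable {} (Suc k) (\<lambda>xs. LEAST n. ?P (n # xs))"
    by (rule computable_Least) (auto simp: length_Suc_conv)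
  let ?L = "\<lambda>xs. LEAST n. ?P (n # xs)"
  let ?v = "\<lambda>xs. ?f (map (\<lambda>h. h xs) [hd, ?L] @ drop 1 xs)"
  have "computable {} (1 + k) ?v"
    by (rule computable_comp_drop) (use Mu.IH[of "Suc k"] L in \<open>auto intro: computable_hd\<close>)
  then have "computable {} (Suc k) (\<lambda>xs. if ?v xs = 1 then Suc (?L xs) else 0)"
    by (intro computable_if decidable_eq computable_Suc computable_const L) simp
  then show ?case
  proof (rule computable_cong)
    fix xs :: "nat list"
    assume "length xs = Suc k"
    then obtain s zs where xs: "xs = s # zs"
      by (auto simp: length_Suc_conv)
    have "option_code z < 2 \<longleftrightarrow> z \<in> {None, Some 0}" for z
      by (cases z) auto
    then have "?L xs = (LEAST n. eval_within s f (n # zs) \<in> {None, Some 0} \<or> n = s)"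
      by (simp add: xs)
    then show "(if ?v xs = 1 then Suc (?L xs) else 0) = option_code (eval_within (hd xs) (Mu f) (tl xs))"
      by (simp add: xs Let_def)
  qed
qed

text \<open>This is Kleene's normal form for a single function; the stage \<open>s\<close> is the
  bound of \<open>eval_within\<close>.\<close>

lemma decidable_stages:
  assumes "partial_computable {} k f"
  shows "\<exists>T. decidable {} (Suc (Suc k)) T \<and>
    (\<forall>xs v. length xs = k \<longrightarrow> (f xs = Some v \<longleftrightarrow> (\<exists>s. T (s # v # xs))))"
proof -
  obtain r where r: "\<And>xs. length xs = k \<Longrightarrow> eval {} r xs = f xs"
    using assms by (auto simp: partial_computable_def)
  let ?E = "\<lambda>ys. option_code (eval_within (hd ys) r (tl ys))"
  let ?T = "\<lambda>ys. ?E (map (\<lambda>h. h ys) [hd] @ drop 2 ys) = Suc (ys ! 1)"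
  have "computable {} (2 + k) (\<lambda>ys. ?E (map (\<lambda>h. h ys) [hd] @ drop 2 ys))"
    by (rule computable_comp_drop) (use computable_eval_within in \<open>auto intro: computable_hd\<close>)
  then have "decidable {} (Suc (Suc k)) ?T"
    by (intro decidable_eq computable_Suc computable_nth) auto
  moreover have "f xs = Some v \<longleftrightarrow> (\<exists>s. ?T (s # v # xs))" if "length xs = k" for xs v
    using r[OF that] eval_within_sound[of _ r xs v] eval_within_complete[of r xs v] by auto
  ultimately show ?thesis by (intro exI[of _ ?T] conjI allI impI)
qed

section \<open>Choice by oracles of PA-complete degree\<close>

lemma all_length_1: "(\<forall>xs. length xs = 1 \<longrightarrow> P xs) \<longleftrightarrow> (\<forall>x. P [x])"
  by (auto simp: length_Suc_conv)

lemma all_length_2: "(\<forall>xs. length xs = 2 \<longrightarrow> P xs) \<longleftrightarrow> (\<forall>x y. P [x, y])"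
  by (auto simp: length_Suc_conv numeral_2_eq_2)

lemma partial_recursive1_iff:
  "partial_recursive1 f \<longleftrightarrow> partial_computable {} 1 (\<lambda>xs. f (xs ! 0))"
  unfolding partial_recursive1_def partial_computable_def all_length_1 nth_Cons_0
  by (rule ex_cong1) (rule all_cong1, rule eq_commute)

lemma partial_recursive2_iff:
  "partial_recursive2 f \<longleftrightarrow> partial_computable {} 2 (\<lambda>xs. f (xs ! 0) (xs ! 1))"
  unfolding partial_recursive2_def partial_computable_def all_length_2 nth_Cons_0 One_nat_def nth_Cons_Suc
  by (rule ex_cong1) (rule all_cong1, rule all_cong1, rule eq_commute)

lemma recursive_in_iff: "recursive_in A f \<longleftrightarrow> computable A 1 (\<lambda>xs. f (xs ! 0))"
  unfolding recursive_in_def computable_def partial_computable_def all_length_1 nth_Cons_0 ..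

text \<open>The exponent of 2 will stand for a number of trailing zeros: the successor of the code
  of a string ending in a 1 and \<open>e\<close> zeros has this form, so unpairing also parses
  programs.\<close>

definition pair :: "nat \<Rightarrow> nat \<Rightarrow> nat" where
  "pair e q = 2 ^ e * (2 * q + 1)"

text \<open>The exponent of 2 in \<open>N\<close>; the disjunct \<open>N = 0\<close> lets the search
  end at 0 for that argument.\<close>

definition pair_fst :: "nat \<Rightarrow> nat" where
  "pair_fst N = (LEAST e. N mod 2 ^ Suc e \<noteq> 0 \<or> N = 0)"

definition pair_snd :: "nat \<Rightarrow> nat" where
  "pair_snd N = N div 2 ^ pair_fst N div 2"

lemma pair_fst_pair [simp]: "pair_fst (pair e q) = e"
  unfolding pair_fst_def
proof (rule Least_equality)
  have "\<not> 2 ^ Suc e dvd pair e q"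
    unfolding pair_def power_Suc2 nat_mult_dvd_cancel_disj by simp
  then show "pair e q mod 2 ^ Suc e \<noteq> 0 \<or> pair e q = 0"
    by (simp add: dvd_eq_mod_eq_0)
  show "e \<le> n" if "pair e q mod 2 ^ Suc n \<noteq> 0 \<or> pair e q = 0" for n
  proof (rule ccontr)
    assume "\<not> e \<le> n"
    then have "2 ^ Suc n dvd pair e q"
      unfolding pair_def by (intro dvd_mult2 le_imp_power_dvd) simp
    then show False
      using that by (simp add: pair_def dvd_eq_mod_eq_0)
  qed
qed

lemma pair_snd_pair [simp]: "pair_snd (pair e q) = q"
  by (simp add: pair_snd_def) (simp add: pair_def)

lemma computable_pair:
  assumes "computable A k f" "computable A k g"
  shows "computable A k (\<lambda>xs. pair (f xs) (g xs))"
  unfolding pair_def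
  by (intro computable_mult computable_power computable_add computable_const assms)

lemma computable_pair_fst:
  assumes "computable A k f"
  shows "computable A k (\<lambda>xs. pair_fst (f xs))"
proof (rule computable_comp1[OF _ assms], rule computable_cong)
  let ?P = "\<lambda>ys :: nat list. \<not> ys ! 1 mod 2 ^ Suc (ys ! 0) = 0 \<or> ys ! 1 = 0"
  show "computable A 1 (\<lambda>xs. LEAST e. ?P (e # xs))"
  proof (rule computable_Least)
    show "decidable A (Suc 1) ?P"
      by (intro decidable_disj decidable_not decidable_eq computable_mod computable_power
          computable_Suc computable_nth computable_const) auto
    have "n < 2 ^ Suc n" for n :: nat
      by (rule less_trans[OF less_exp]) simp
    then have "n mod 2 ^ Suc n = n" for n :: nat
      by (rule mod_less)
    then have "?P (xs ! 0 # xs)" for xs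
      by (auto simp del: power_Suc)
    then show "\<exists>n. ?P (n # xs)" for xs ..
  qed
qed (simp add: pair_fst_def)

lemma computable_pair_snd:
  assumes "computable A k f"
  shows "computable A k (\<lambda>xs. pair_snd (f xs))"
  unfolding pair_snd_def
  by (intro computable_div computable_power computable_pair_fst computable_const assms)

text \<open>
  The partial function that halts with 0 if \<open>i\<close> is enumerated first and with 1 if \<open>j\<close> is has an
  index computable from \<open>a, i, j\<close>, so a two-valued DNR function can tell a candidate that is never
  enumerated from one that is.
\<close>

lemma PA_choose_of_two:
  assumes \<phi>: "acceptable_numbering \<phi>"
    and A: "PA_complete \<phi> A"
    and E: "decidable {} 3 (\<lambda>xs. E (xs ! 0) (xs ! 1) (xs ! 2))"
  shows "\<exists>c. computable A 3 (\<lambda>xs. c (xs ! 0) (xs ! 1) (xs ! 2)) \<and>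
    (\<forall>a i j. c a i j \<in> {i, j} \<and>
       ((\<forall>s. \<not> E s a i) \<or> (\<forall>s. \<not> E s a j) \<longrightarrow> (\<forall>s. \<not> E s a (c a i j))))"
proof -
  obtain f where f: "recursive_in A f" "range f \<subseteq> {0, 1}" "DNR \<phi> f"
    using A by (auto simp: PA_complete_def)
  let ?a = "\<lambda>z. pair_fst z" and ?i = "\<lambda>z. pair_fst (pair_snd z)" and ?j = "\<lambda>z. pair_snd (pair_snd z)"
  let ?P = "\<lambda>t z. E t (?a z) (?i z) \<or> E t (?a z) (?j z)"
  let ?g = "\<lambda>t z. if E t (?a z) (?i z) then 0 else 1 :: nat"
  \<comment> \<open>\<open>\<psi> z\<close> ignores its argument, so its value at its own index
    \<open>s z\<close> is the outcome of the race between the \<open>i\<close> and \<open>j\<close>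
    coded in \<open>z\<close>. A tie counts as 0.\<close>
  define \<psi> where "\<psi> z y = map_option (\<lambda>t. ?g t z) (if \<exists>t. ?P t z then Some (LEAST t. ?P t z) else None)"
    for z y :: nat
  have E': "decidable {} k (\<lambda>xs. E (f xs) (g xs) (h xs))"
    if "computable {} k f" "computable {} k g" "computable {} k h" for k f g h
    using computable_comp3[of "{}" "\<lambda>x y z. of_bool (E x y z)"] E that by simp
  have "partial_computable {} 2 (\<lambda>xs. map_option (\<lambda>t. ?g ((t # xs) ! 0) ((t # xs) ! 1))
      (if \<exists>t. ?P ((t # xs) ! 0) ((t # xs) ! 1) then Some (LEAST t. ?P ((t # xs) ! 0) ((t # xs) ! 1)) else None))"
    by (intro partial_computable_map_option partial_computable_Least computable_if decidable_disj E'
        computable_const computable_pair_fst computable_pair_snd computable_nth) auto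
  then have "partial_recursive2 \<psi>"
    unfolding partial_recursive2_iff \<psi>_def by (simp cong: if_cong)
  then obtain s where s: "recursive_in {} s" "\<And>z. \<phi> (s z) = \<psi> z"
    using \<phi> unfolding acceptable_numbering_def by blast
  have \<psi>: "\<psi> z y = Some (?g (LEAST t. ?P t z) z)" if "?P t z" for t z y
  proof -
    have "\<exists>t. ?P t z" using that by blast
    then show ?thesis unfolding \<psi>_def by (simp only: if_True option.map)
  qed
  have fs: "f (s z) \<noteq> 0" if "\<psi> z (s z) = Some 0" for z
  proof -
    have "\<phi> (s z) (s z) = Some 0" using that s(2) by simp
    then show ?thesis using f(3) by (auto simp: DNR_def)
  qed
  have fs': "f (s z) = 0" if "\<psi> z (s z) = Some 1" for z
  proof -
    have "\<phi> (s z) (s z) = Some 1" using that s(2) by simp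
    then have "f (s z) \<noteq> 1" using f(3) by (auto simp: DNR_def)
    then show ?thesis using f(2) by auto
  qed
  \<comment> \<open>If \<open>i\<close> comes first, the race has value 0, which \<open>f\<close>
    avoids, so \<open>j\<close> is chosen. If \<open>j\<close> comes first, \<open>f\<close> avoids
    1 and hence is 0, so \<open>i\<close> is chosen.\<close>
  let ?c = "\<lambda>a i j. if f (s (pair a (pair i j))) = 0 then i else j"
  have fsg: "computable A k (\<lambda>xs. f (s (g xs)))" if "computable A k g" for k g
    using computable_comp1[of A f, OF f(1)[unfolded recursive_in_iff]
        computable_comp1[of A s, OF computable_relativize[OF s(1)[unfolded recursive_in_iff]] that]] .
  have "computable A 3 (\<lambda>xs. ?c (xs ! 0) (xs ! 1) (xs ! 2))"
    by (intro computable_if decidable_eq fsg computable_pair computable_nth computable_const) auto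
  moreover have "\<not> E t a (?c a i j)" if non: "(\<forall>s. \<not> E s a i) \<or> (\<forall>s. \<not> E s a j)" for a i j t
  proof (cases "\<exists>t. E t a i \<or> E t a j")
    case True
    let ?z = "pair a (pair i j)"
    from True obtain t where P: "?P t ?z" by auto
    then have L: "?P (LEAST t. ?P t ?z) ?z"
      by (rule LeastI)
    show ?thesis
    proof (cases "\<exists>s. E s a i")
      case True
      then have "\<psi> ?z (s ?z) = Some 0"
        using non L \<psi>[OF P, of "s ?z"] by (auto split: if_splits)
      then have "f (s ?z) \<noteq> 0" by (rule fs)
      then show ?thesis using non True by auto
    next
      case False
      then have "\<psi> ?z (s ?z) = Some 1"
        using \<psi>[OF P, of "s ?z"] by (auto split: if_splits)
      then have "f (s ?z) = 0" by (rule fs')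
      then show ?thesis using False by simp
    qed
  qed auto
  ultimately show ?thesis
    by (intro exI[of _ ?c] conjI allI impI) auto
qed

text \<open>In the tournament the current winner meets the next candidate. Once a candidate that is
  never enumerated has taken part, all later winners are of this kind, since each later match
  involves one.\<close>

lemma PA_choose_of_interval:
  assumes \<phi>: "acceptable_numbering \<phi>"
    and A: "PA_complete \<phi> A"
    and E: "decidable {} 3 (\<lambda>xs. E (xs ! 0) (xs ! 1) (xs ! 2))"
  shows "\<exists>w. computable A 3 (\<lambda>xs. w (xs ! 0) (xs ! 1) (xs ! 2)) \<and>
    (\<forall>a b k. w a b k \<in> {b..b + k} \<and>
       ((\<exists>x\<in>{b..b + k}. \<forall>s. \<not> E s a x) \<longrightarrow> (\<forall>s. \<not> E s a (w a b k))))"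
proof -
  obtain c where c: "computable A 3 (\<lambda>xs. c (xs ! 0) (xs ! 1) (xs ! 2))"
    "\<And>a i j. c a i j \<in> {i, j}"
    "\<And>a i j s. (\<forall>s. \<not> E s a i) \<or> (\<forall>s. \<not> E s a j) \<Longrightarrow> \<not> E s a (c a i j)"
    using PA_choose_of_two[OF assms] by blast
  define w where "w a b k = rec_nat b (\<lambda>n v. c a v (b + Suc n)) k" for a b k
  have "computable A 3 (\<lambda>xs. rec_nat (xs ! 1)
      (\<lambda>n v. (\<lambda>ys. c (ys ! 2) (ys ! 1) (ys ! 3 + Suc (ys ! 0))) (n # v # xs)) (xs ! 2))"
    by (intro computable_rec_nat computable_comp3[OF c(1)] computable_add computable_Suc
        computable_nth) auto
  then have "computable A 3 (\<lambda>xs. w (xs ! 0) (xs ! 1) (xs ! 2))"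
    by (simp add: w_def numeral_2_eq_2 numeral_3_eq_3)
  moreover have "w a b k \<in> {b..b + k}" for a b k
  proof (induction k)
    case (Suc k)
    then show ?case
      using c(2)[of a "w a b k" "b + Suc k"] by (auto simp: w_def)
  qed (simp add: w_def)
  moreover have "\<not> E s a (w a b k)" if "x \<in> {b..b + k}" "\<forall>s. \<not> E s a x" for a b k x s
    using that(1)
  proof (induction k arbitrary: s)
    case 0
    then show ?case using that(2) by (simp add: w_def)
  next
    case (Suc k)
    then have "(\<forall>s. \<not> E s a (w a b k)) \<or> (\<forall>s. \<not> E s a (b + Suc k))"
      using that(2) by (cases "x = b + Suc k") auto
    then show ?case
      using c(3)[of a "w a b k" "b + Suc k" s] by (simp add: w_def)
  qed
  ultimately show ?thesis
    by (intro exI[of _ w]) blast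
qed

section \<open>The universal machine\<close>

lemma decode_str_code [simp]: "inv str_code (str_code p) = p"
  by (rule inv_f_f[OF bij_is_inj[OF bij_str_code]])

lemma str_code_decode [simp]: "str_code (inv str_code c) = c"
  by (rule surj_f_inv_f[OF bij_is_surj[OF bij_str_code]])

text \<open>The number \<open>Suc (str_code p)\<close> has the binary expansion 1 followed by
  \<open>p\<close>, hence \<open>length p + 1\<close> digits.\<close>

lemma str_code_bounds: "2 ^ length p \<le> Suc (str_code p)" "Suc (str_code p) < 2 ^ Suc (length p)"
  by (induction p rule: rev_induct) auto

text \<open>Turns quantification over shorter programs into bounded quantification over
  codes.\<close>

lemma str_code_less_iff: "str_code p < 2 ^ n - 1 \<longleftrightarrow> length p < n"
proof
  assume "str_code p < 2 ^ n - 1"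
  then have "(2::nat) ^ length p < 2 ^ n"
    using str_code_bounds(1)[of p] by linarith
  then show "length p < n" by simp
next
  assume "length p < n"
  then have "(2::nat) ^ Suc (length p) \<le> 2 ^ n"
    by (intro power_increasing) auto
  then show "str_code p < 2 ^ n - 1"
    using str_code_bounds(2)[of p] by linarith
qed

text \<open>The interval, of \<open>2 ^ n\<close> numbers, is written in the form
  \<open>{b..b + k}\<close> of the tournament, with \<open>b = k = 2 ^ n - 1\<close>.\<close>

lemma length_eq_iff_str_code: "length p = n \<longleftrightarrow> str_code p \<in> {2 ^ n - 1..2 ^ n - 1 + (2 ^ n - 1)}"
proof -
  have "length p = n \<longleftrightarrow> \<not> length p < n \<and> length p < Suc n" by auto
  also have "\<dots> \<longleftrightarrow> str_code p \<in> {2 ^ n - 1..2 ^ n - 1 + (2 ^ n - 1)}"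
    unfolding str_code_less_iff[symmetric] by (cases "(2::nat) ^ n") auto
  finally show ?thesis .
qed

lemma length_decode: "length (inv str_code c) = (LEAST n. Suc c < 2 ^ Suc n)"
proof (rule sym, rule Least_equality)
  let ?p = "inv str_code c"
  show "Suc c < 2 ^ Suc (length ?p)"
    using str_code_bounds(2)[of ?p] by simp
  show "length ?p \<le> n" if "Suc c < 2 ^ Suc n" for n
  proof -
    have "(2::nat) ^ length ?p < 2 ^ Suc n"
      using str_code_bounds(1)[of ?p] that by simp
    then show ?thesis
      using power_less_imp_less_exp[of "2::nat" "length ?p" "Suc n"] by simp
  qed
qed

lemma computable_length_decode:
  assumes "computable A k f"
  shows "computable A k (\<lambda>xs. length (inv str_code (f xs)))"
proof (rule computable_comp1[OF _ assms], rule computable_cong)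
  let ?P = "\<lambda>ys :: nat list. Suc (ys ! 1) < 2 ^ Suc (ys ! 0)"
  show "computable A 1 (\<lambda>xs. LEAST n. ?P (n # xs))"
  proof (rule computable_Least)
    show "decidable A (Suc 1) ?P"
      by (intro decidable_less computable_power computable_Suc computable_nth computable_const) auto
    have "?P (length (inv str_code (xs ! 0)) # xs)" for xs
      using str_code_bounds(2)[of "inv str_code (xs ! 0)"] by simp
    then show "\<exists>n. ?P (n # xs)" for xs ..
  qed
qed (simp add: length_decode)

text \<open>Appending a zero to the string appends the binary digit 0 to the successor of its code,
  that is, doubles it.\<close>

lemma str_code_replicate_False:
  "Suc (str_code (p @ replicate e False)) = 2 ^ e * Suc (str_code p)"
proof (induction e)
  case (Suc e)
  have "p @ replicate (Suc e) False = (p @ replicate e False) @ [False]"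
    by (simp add: replicate_append_same)
  then have "Suc (str_code (p @ replicate (Suc e) False)) = 2 * Suc (str_code (p @ replicate e False))"
    by (simp only: str_code_snoc if_False mult_Suc_right add_2_eq_Suc plus_1_eq_Suc)
  then show ?case using Suc.IH by simp
qed simp

lemma str_code_True_replicate_False:
  "Suc (str_code (p @ True # replicate e False)) = pair e (Suc (str_code p))"
  using str_code_replicate_False[of "p @ [True]" e] by (simp add: pair_def)

text \<open>The function is viewed as a family that is constant in its parameter; parametrization
  then yields an index for it at any parameter.\<close>

lemma acceptable_index:
  assumes "acceptable_numbering \<phi>" and "partial_recursive1 f"
  shows "\<exists>e. \<phi> e = f"
proof -
  obtain r where "\<forall>x. f x = eval {} r [x]"
    using assms(2) by (auto simp: partial_recursive1_def)
  then have "\<forall>x y. f y = eval {} (Comp r [Proj 1]) [x, y]"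
    by simp
  then have "partial_recursive2 (\<lambda>_. f)"
    unfolding partial_recursive2_def by blast
  then show ?thesis
    using assms(1) unfolding acceptable_numbering_def by blast
qed

text \<open>A search whose predicate ignores the candidate stops at 0 if \<open>P\<close> holds and
  diverges otherwise.\<close>

lemma partial_computable_guard:
  assumes P: "decidable A k P" and f: "computable A k f"
  shows "partial_computable A k (\<lambda>xs. if P xs then Some (f xs) else None)"
proof (rule partial_computable_cong)
  show "partial_computable A k (\<lambda>xs. map_option (\<lambda>v. (\<lambda>ys. f (tl ys)) (v # xs))
      (if \<exists>n. (\<lambda>ys. P (tl ys)) (n # xs) then Some (LEAST n. (\<lambda>ys. P (tl ys)) (n # xs)) else None))"
    by (intro partial_computable_map_option partial_computable_Least computable_tl f)
      (rule P)
qed simp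

text \<open>
  A program is a string \<open>y\<close> followed by the bit 1 and \<open>e\<close> zeros, read from its end: under
  \<open>str_code\<close>, a suffix is arithmetic on the code. \<open>e\<close> selects the case, and the length of \<open>y\<close> the
  number about which the last bit informs.
\<close>

definition mark :: "(nat \<Rightarrow> nat \<rightharpoonup> nat) \<Rightarrow> nat set \<Rightarrow> nat \<rightharpoonup> nat" where
  "mark \<phi> B m = (if even m then \<phi> (m div 2) (m div 2) else if m div 2 \<in> B then Some 0 else None)"

text \<open>The case of three zeros is left undefined so that simulating programs end in at least
  four. Those shorter than \<open>n + 3\<close> then have the form
  \<open>r @ replicate 4 False\<close> with \<open>r\<close> shorter than \<open>n - 1\<close>, so
  there are fewer than \<open>2 ^ (n - 1)\<close> of them for positive \<open>n\<close>.\<close>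

locale marking_machine =
  fixes \<phi> :: "nat \<Rightarrow> nat \<rightharpoonup> nat" and B :: "nat set" and U :: "bool list \<rightharpoonup> bool list"
  assumes machine_U: "machine U"
    and U_zeros: "U (replicate e False) = None"
    and U_mark: "U (y @ [True]) = map_option (\<lambda>v. y @ [odd v]) (mark \<phi> B (length y))"
    and U_odd: "U (y @ [True, False]) = (if odd (length y) then Some (y @ [True]) else None)"
    and U_copy: "U (y @ [True, False, False]) = Some y"
    and U_undefined: "U (y @ [True, False, False, False]) = None"
    and U_simulate: "U (y @ True # replicate (e + 4) False) = map_option (inv str_code) (\<phi> e (str_code y))"

text \<open>Each case is a partial recursive function with an index of its own. The machine is a
  single call of \<open>\<phi>\<close> at an index computed from the program, so the case
  distinction is made among indices and not among partial values.\<close>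

lemma marking_machine_exists:
  assumes \<phi>: "acceptable_numbering \<phi>" and B: "recursively_enumerable B"
  shows "\<exists>U. marking_machine \<phi> B U"
proof -
  have \<phi>': "partial_computable {} k (\<lambda>xs. \<phi> (f xs) (g xs))"
    if "computable {} k f" "computable {} k g" for k f g
    using partial_computable_comp2[of "{}" \<phi>] \<phi> that
    by (simp add: acceptable_numbering_def partial_recursive2_iff)
  have "partial_recursive1 (\<lambda>x. \<phi> x x)"
    unfolding partial_recursive1_iff by (intro \<phi>' computable_nth) simp_all
  then obtain d where d: "\<phi> d = (\<lambda>x. \<phi> x x)"
    using acceptable_index[OF \<phi>] by blast
  obtain b where b: "B = dom (\<phi> b)"
    using B acceptable_index[OF \<phi>] unfolding recursively_enumerable_def by blast
  \<comment> \<open>A function with domain \<open>B\<close> may have any values. They are replaced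
    by 0, so that \<open>mark\<close> favours the last bit 0.\<close>
  have "partial_computable {} 1 (\<lambda>xs. map_option (\<lambda>v. (\<lambda>_. 0) (v # xs)) (\<phi> b (xs ! 0)))"
    by (intro partial_computable_map_option \<phi>' computable_const computable_nth) simp
  then have "partial_recursive1 (\<lambda>x. map_option (\<lambda>_. 0) (\<phi> b x))"
    unfolding partial_recursive1_iff .
  then obtain b' where "\<phi> b' = (\<lambda>x. map_option (\<lambda>_. 0) (\<phi> b x))"
    using acceptable_index[OF \<phi>] by blast
  then have b': "\<phi> b' x = (if x \<in> B then Some 0 else None)" for x
    unfolding b by (cases "\<phi> b x") (simp_all add: domIff)
  let ?len = "\<lambda>c. length (inv str_code c)"
  \<comment> \<open>For the code \<open>c\<close> of \<open>y\<close>, the number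
    \<open>2 * c + 1 + v mod 2\<close> is the code of \<open>y @ [odd v]\<close>. The indices
    \<open>d\<close> and \<open>b'\<close> provide the two cases of \<open>mark\<close>.\<close>
  have "partial_computable {} 1 (\<lambda>xs. map_option (\<lambda>v. (\<lambda>ys. 2 * ys ! 1 + 1 + ys ! 0 mod 2) (v # xs))
      (\<phi> (if even (?len (xs ! 0)) then d else b') (?len (xs ! 0) div 2)))"
    by (intro partial_computable_map_option \<phi>' computable_if decidable_even computable_div
        computable_mod computable_mult computable_add computable_length_decode computable_nth
        computable_const) simp_all
  then have "partial_recursive1 (\<lambda>c. map_option (\<lambda>v. 2 * c + 1 + v mod 2)
      (\<phi> (if even (?len c) then d else b') (?len c div 2)))"
    unfolding partial_recursive1_iff by simp
  then obtain i0 where i0: "\<phi> i0 = (\<lambda>c. map_option (\<lambda>v. 2 * c + 1 + v mod 2)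
      (\<phi> (if even (?len c) then d else b') (?len c div 2)))"
    using acceptable_index[OF \<phi>] by blast
  have "partial_recursive1 (\<lambda>c. if \<not> even (?len c) then Some (2 * c + 2) else None)"
    unfolding partial_recursive1_iff
    by (intro partial_computable_guard decidable_not decidable_even computable_length_decode
        computable_add computable_mult computable_nth computable_const) simp_all
  then obtain i1 where i1: "\<phi> i1 = (\<lambda>c. if \<not> even (?len c) then Some (2 * c + 2) else None)"
    using acceptable_index[OF \<phi>] by blast
  have "partial_recursive1 Some"
    unfolding partial_recursive1_iff computable_def[symmetric] by (rule computable_nth) simp
  then obtain i2 where i2: "\<phi> i2 = Some"
    using acceptable_index[OF \<phi>] by blast
  have "partial_recursive1 (\<lambda>_. None)"
    unfolding partial_recursive1_def by (rule exI[of _ "Proj 1"]) simp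
  then obtain i3 where i3: "\<phi> i3 = (\<lambda>_. None)"
    using acceptable_index[OF \<phi>] by blast
  \<comment> \<open>Here \<open>q = 0\<close> means that the program consists of zeros only;
    otherwise \<open>q - 1\<close> is the code of \<open>y\<close>. From \<open>e = 4\<close> on,
    \<open>e - 4\<close> is the index of the simulated function.\<close>
  define \<iota> where "\<iota> e q = (if q = 0 then i3 else if e = 0 then i0 else if e = 1 then i1
      else if e = 2 then i2 else if e = 3 then i3 else e - 4)" for e q :: nat
  define g where "g c = \<phi> (\<iota> (pair_fst (Suc c)) (pair_snd (Suc c))) (pair_snd (Suc c) - 1)" for c
  have "partial_recursive1 g"
    unfolding partial_recursive1_iff g_def \<iota>_def
    by (intro \<phi>' computable_if decidable_eq computable_diff computable_pair_fst computable_pair_snd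
        computable_Suc computable_nth computable_const) simp_all
  define U where "U p = map_option (inv str_code) (g (str_code p))" for p
  have U: "U (y @ True # replicate e False) =
      map_option (inv str_code) (\<phi> (\<iota> e (Suc (str_code y))) (str_code y))" for y e
    by (simp add: U_def g_def str_code_True_replicate_False)
  have "marking_machine \<phi> B U"
  proof
    have "map_option str_code (U p) = g (str_code p)" for p
      by (simp add: U_def option.map_comp o_def option.map_ident)
    then show "machine U"
      using \<open>partial_recursive1 g\<close> unfolding machine_def by blast
  next
    fix e
    have "Suc (str_code (replicate e False)) = pair e 0"
      using str_code_replicate_False[of "[]" e] by (simp add: pair_def)
    then show "U (replicate e False) = None"
      by (simp add: U_def g_def \<iota>_def i3)
  next
    fix y
    have "inv str_code (2 * str_code y + 1 + v mod 2) = y @ [odd v]" for v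
    proof -
      have "2 * str_code y + 1 + v mod 2 = str_code (y @ [odd v])"
        by (simp add: odd_iff_mod_2_eq_one)
      then show ?thesis by (simp only: decode_str_code)
    qed
    then show "U (y @ [True]) = map_option (\<lambda>v. y @ [odd v]) (mark \<phi> B (length y))"
      using U[of y 0] by (simp add: \<iota>_def i0 mark_def d b' option.map_comp o_def)
  next
    fix y
    have "inv str_code (2 * str_code y + 2) = y @ [True]"
      using decode_str_code[of "y @ [True]"] by simp
    then show "U (y @ [True, False]) = (if odd (length y) then Some (y @ [True]) else None)"
      using U[of y 1] by (simp add: \<iota>_def i1)
  next
    show "U (y @ [True, False, False]) = Some y" for y
      using U[of y 2] by (simp add: \<iota>_def i2 numeral_2_eq_2)
    show "U (y @ [True, False, False, False]) = None" for y
      using U[of y 3] by (simp add: \<iota>_def i3 numeral_3_eq_3)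
    show "U (y @ True # replicate (e + 4) False) = map_option (inv str_code) (\<phi> e (str_code y))" for y e
      using U[of y "e + 4"] by (simp add: \<iota>_def)
  qed
  then show ?thesis by (rule exI[of _ U])
qed

section \<open>Strings of maximal complexity\<close>

lemma plain_complexity_less_iff:
  "plain_complexity V x < enat m \<longleftrightarrow> (\<exists>p. length p < m \<and> V p = Some x)"
  unfolding plain_complexity_def Inf_less_iff by auto

lemma le_plain_complexity_iff:
  "enat m \<le> plain_complexity V x \<longleftrightarrow> (\<forall>p. V p = Some x \<longrightarrow> m \<le> length p)"
  unfolding plain_complexity_def le_Inf_iff by auto

lemma plain_complexity_le: "V p = Some x \<Longrightarrow> plain_complexity V x \<le> enat (length p)"
  unfolding plain_complexity_def by (rule Inf_lower) blast

lemma split_program: "(\<exists>e. p = replicate e False) \<or> (\<exists>y e. p = y @ True # replicate e False)"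
proof (induction p rule: rev_induct)
  case (snoc b p)
  show ?case
  proof (cases b)
    case True
    then have "p @ [b] = p @ True # replicate 0 False" by simp
    then show ?thesis by blast
  next
    case False
    have *: "replicate e False @ [b] = replicate (Suc e) False" for e
      using False by (simp add: replicate_append_same)
    from snoc.IH show ?thesis
    proof (elim disjE exE)
      fix e
      assume "p = replicate e False"
      then have "p @ [b] = replicate (Suc e) False" using * by simp
      then show ?thesis by blast
    next
      fix y e
      assume "p = y @ True # replicate e False"
      then have "p @ [b] = y @ True # replicate (Suc e) False" using *[of e] by simp
      then show ?thesis by blast
    qed
  qed
next
  case Nil
  have "[] = replicate 0 False" by simp
  then show ?case by blast
qed

lemma card_short_strings: "card {r :: bool list. length r < m} < 2 ^ m"
proof (induction m)
  case (Suc m)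
  have "{r :: bool list. length r < Suc m} = {r. length r < m} \<union> {r. length r = m}"
    by auto
  also have "card \<dots> \<le> card {r :: bool list. length r < m} + card {r :: bool list. length r = m}"
    by (rule card_Un_le)
  also have "card {r :: bool list. length r = m} = 2 ^ m"
    using card_lists_length_eq[of "UNIV :: bool set" m] by simp
  finally show ?case using Suc.IH by simp
qed simp

text \<open>Pigeonhole: there are \<open>2 ^ m\<close> strings \<open>y\<close> but fewer
  \<open>r\<close>. The suffix \<open>s\<close> will be the four zeros of a simulation, and
  \<open>t\<close> the chosen last bit.\<close>

lemma exists_string_not_described:
  fixes V :: "bool list \<rightharpoonup> bool list"
  shows "\<exists>y. length y = m \<and> (\<forall>r. length r < m \<longrightarrow> V (r @ s) \<noteq> Some (y @ t))"
proof (rule ccontr)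
  assume neg: "\<not> ?thesis"
  have fin: "finite {r :: bool list. length r < m}"
    using finite_lists_length_le[of "UNIV :: bool set" m] by (auto elim: finite_subset[rotated])
  have "(\<lambda>y. Some (y @ t)) ` {y. length y = m} \<subseteq> (\<lambda>r. V (r @ s)) ` {r. length r < m}"
  proof
    fix z
    assume "z \<in> (\<lambda>y. Some (y @ t)) ` {y. length y = m}"
    then obtain y where "length y = m" "z = Some (y @ t)" by blast
    then obtain r where "length r < m" "V (r @ s) = z" using neg by blast
    then show "z \<in> (\<lambda>r. V (r @ s)) ` {r. length r < m}" by blast
  qed
  then have "card ((\<lambda>y. Some (y @ t)) ` {y. length y = m}) \<le> card {r :: bool list. length r < m}"
    using fin by (rule surj_card_le[rotated])
  moreover have "card ((\<lambda>y. Some (y @ t)) ` {y. length y = m}) = 2 ^ m"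
    using card_lists_length_eq[of "UNIV :: bool set" m] by (subst card_image) (auto simp: inj_on_def)
  ultimately show False
    using card_short_strings[of m] by simp
qed

context marking_machine
begin

text \<open>Each clause for \<open>U\<close> is inverted. Copying takes exactly
  \<open>length y + 4\<close> bits and so falls under the third alternative, together with the long
  simulations; the last alternative leaves the short simulations to the counting argument.\<close>

lemma program_cases:
  assumes p: "U p = Some (y @ [b])"
  shows "(\<exists>v. mark \<phi> B (length y) = Some v \<and> b = odd v) \<or>
    (odd (length y) \<and> b \<and> length p = length y + 2) \<or> length y + 4 \<le> length p \<or>
    (\<exists>r. length r < length y \<and> p = r @ replicate 4 False)"
proof -
  consider e where "p = replicate e False" | z e where "p = z @ True # replicate e False"
    using split_program[of p] by blast
  then show ?thesis
  proof cases
    case 1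
    then show ?thesis using p U_zeros[of e] by simp
  next
    case 2
    consider "e = 0" | "e = 1" | "e = 2" | "e = 3" | e' where "e = e' + 4"
    proof -
      have "e = 0 \<or> e = 1 \<or> e = 2 \<or> e = 3 \<or> e = (e - 4) + 4" by presburger
      then show ?thesis using that by blast
    qed
    then show ?thesis
    proof cases
      case 1
      then show ?thesis using 2 p U_mark[of z] by auto
    next
      case p1: 2
      then show ?thesis using 2 p U_odd[of z] by (auto split: if_splits)
    next
      case 3
      then show ?thesis using 2 p U_copy[of z] by (simp add: numeral_2_eq_2)
    next
      case 4
      then show ?thesis using 2 p U_undefined[of z] by (simp add: numeral_3_eq_3)
    next
      case 5
      let ?r = "z @ True # replicate e' False"
      have "p = ?r @ replicate 4 False"
        unfolding 2 5 by (simp add: replicate_add)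
      then show ?thesis
      proof (cases "length ?r < length y")
        case True
        then show ?thesis using \<open>p = ?r @ replicate 4 False\<close> by blast
      next
        case False
        then have "length y + 4 \<le> length p" using \<open>p = ?r @ replicate 4 False\<close> by simp
        then show ?thesis by blast
      qed
    qed
  qed
qed

text \<open>For \<open>n = 2 e + 2\<close> with \<open>e\<close> in \<open>B\<close> both last bits
  are favoured, 0 by programs of length \<open>n\<close> and 1 by programs of length
  \<open>n + 1\<close>. In the other cases with positive \<open>n\<close>, some last bit is left to
  copying, which costs \<open>n + 3\<close>.\<close>

definition max_complexity :: "nat \<Rightarrow> nat" where
  "max_complexity n = (if even n \<and> 0 < n \<and> (n - 1) div 2 \<in> B then n + 1 else n + 3)"

lemma complexity_mark:
  "mark \<phi> B (length y) = Some v \<Longrightarrow> plain_complexity U (y @ [odd v]) \<le> enat (length y + 1)"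
  using plain_complexity_le[of U "y @ [True]" "y @ [odd v]"] U_mark[of y] by simp

lemma complexity_odd:
  "odd (length y) \<Longrightarrow> plain_complexity U (y @ [True]) \<le> enat (length y + 2)"
  using plain_complexity_le[of U "y @ [True, False]" "y @ [True]"] U_odd[of y] by simp

lemma complexity_le_max: "plain_complexity U x \<le> enat (max_complexity (length x))"
proof (cases "even (length x) \<and> 0 < length x \<and> (length x - 1) div 2 \<in> B")
  case True
  then obtain y b where x: "x = y @ [b]"
    by (cases x rule: rev_cases) auto
  have y: "odd (length y)" "length y div 2 \<in> B"
    using True x by auto
  show ?thesis
  proof (cases b)
    case True
    then show ?thesis using x y complexity_odd[of y] by (simp add: max_complexity_def)
  next
    case False
    have "plain_complexity U x \<le> enat (length y + 1)"
      using complexity_mark[of y 0] x y False by (simp add: mark_def)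
    also have "\<dots> \<le> enat (max_complexity (length x))"
      using x by (simp add: max_complexity_def)
    finally show ?thesis .
  qed
next
  case False
  then show ?thesis
    using plain_complexity_le[of U "x @ [True, False, False]" x] U_copy[of x]
    by (auto simp: max_complexity_def numeral_3_eq_3)
qed

text \<open>The last bit is chosen to be favoured as little as possible, the rest by counting so
  that no short simulation describes the string.\<close>

lemma exists_max_complexity:
  "\<exists>x. length x = Suc m \<and> enat (max_complexity (Suc m)) \<le> plain_complexity U x"
proof -
  \<comment> \<open>For \<open>m = 2 e\<close>, \<open>b\<close> is the opposite of
    \<open>odd v\<close> if \<open>mark\<close> has a value \<open>v\<close>. For
    \<open>m = 2 e + 1\<close>, it is 0 if \<open>e\<close> is outside \<open>B\<close>, which
    escapes both ways of shortening, and 1 otherwise, which leaves only the weaker one.\<close>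
  define b where "b \<longleftrightarrow> (if even m then mark \<phi> B m = None \<or> even (the (mark \<phi> B m)) else m div 2 \<in> B)"
  have b: "mark \<phi> B m = Some v \<Longrightarrow> b \<noteq> odd v" for v
    by (cases "even m") (auto simp: b_def, auto simp: mark_def split: if_splits)
  obtain y where y: "length y = m" "\<And>r. length r < m \<Longrightarrow> U (r @ replicate 4 False) \<noteq> Some (y @ [b])"
    using exists_string_not_described[of m U "replicate 4 False" "[b]"] by blast
  have "max_complexity (Suc m) \<le> length p" if "U p = Some (y @ [b])" for p
    using program_cases[OF that] y b that by (auto simp: max_complexity_def b_def)
  then show ?thesis
    using y(1) by (intro exI[of _ "y @ [b]"]) (simp add: le_plain_complexity_iff)
qed

text \<open>With \<open>n = Suc (length y)\<close>, the bit favoured by \<open>mark\<close> caps the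
  complexity at \<open>n\<close>, below every value of \<open>max_complexity n\<close>. For even
  \<open>n\<close>, the bit 1 caps it at \<open>n + 1\<close>, too little if the value is
  \<open>n + 3\<close>.\<close>

lemma last_bit_of_max:
  assumes "\<And>x. length x = Suc (length y) \<Longrightarrow> plain_complexity U x \<le> plain_complexity U (y @ [b])"
  shows "mark \<phi> B (length y) = Some v \<Longrightarrow> b \<noteq> odd v"
    and "odd (length y) \<Longrightarrow> length y div 2 \<notin> B \<Longrightarrow> \<not> b"
proof -
  have M: "enat (max_complexity (Suc (length y))) \<le> plain_complexity U (y @ [b])"
    using exists_max_complexity[of "length y"] assms order_trans by blast
  show "b \<noteq> odd v" if "mark \<phi> B (length y) = Some v"
  proof
    assume "b = odd v"
    then have "enat (max_complexity (Suc (length y))) \<le> enat (length y + 1)"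
      using M complexity_mark[OF that] order_trans by blast
    then show False by (simp add: max_complexity_def split: if_splits)
  qed
  show "\<not> b" if "odd (length y)" "length y div 2 \<notin> B"
  proof
    assume b
    then have "enat (max_complexity (Suc (length y))) \<le> enat (length y + 2)"
      using M complexity_odd[OF that(1)] order_trans by (metis (full_types))
    then show False using that by (simp add: max_complexity_def split: if_splits)
  qed
qed

lemma universal_U:
  assumes \<phi>: "acceptable_numbering \<phi>"
  shows "universal_machine U"
  unfolding universal_machine_def
proof (intro conjI allI impI machine_U)
  fix V
  assume "machine V"
  then obtain f where "partial_recursive1 f" and f: "\<And>p. map_option str_code (V p) = f (str_code p)"
    by (auto simp: machine_def)
  then obtain d where d: "\<phi> d = f"
    using acceptable_index[OF \<phi>] by blast
  \<comment> \<open>The program for \<open>V\<close> is extended by a 1 and \<open>d + 4\<close>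
    zeros.\<close>
  have "plain_complexity U x \<le> plain_complexity V x + enat (d + 5)" for x
  proof (cases "plain_complexity V x")
    case (enat m)
    then obtain p where p: "length p < Suc m" "V p = Some x"
      using plain_complexity_less_iff[of V x "Suc m"] by auto
    have "U (p @ True # replicate (d + 4) False) = Some x"
      using p(2) f[of p] by (simp only: U_simulate d) (simp flip: f)
    then have "plain_complexity U x \<le> enat (length (p @ True # replicate (d + 4) False))"
      by (rule plain_complexity_le)
    also have "\<dots> \<le> enat (m + (d + 5))"
      using p(1) by simp
    finally show ?thesis by (simp add: enat)
  qed simp
  then show "\<exists>c. \<forall>x. plain_complexity U x \<le> plain_complexity V x + enat c" by blast
qed

lemma PA_from_max:
  assumes "string_fun_recursive_in A F"
    and F: "\<And>n x. length x = n \<Longrightarrow> length (F n) = n \<and> plain_complexity U (F n) \<ge> plain_complexity U x"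
  shows "PA_complete \<phi> A" and "B \<le>\<^sub>T A"
proof -
  \<comment> \<open>\<open>str_code (y @ [b])\<close> is even exactly if \<open>b\<close> holds, so
    \<open>g\<close> reads off the last bit. It is evaluated below at positive lengths only.\<close>
  define g where "g n = (if even (str_code (F n)) then 1 else 0 :: nat)" for n
  have F': "computable A k (\<lambda>xs. str_code (F (f xs)))" if "computable A k f" for k f
    using computable_comp1[OF assms(1)[unfolded string_fun_recursive_in_def recursive_in_iff] that] .
  have g: "computable A 1 (\<lambda>xs. g (2 * xs ! 0 + c))" for c
    unfolding g_def
    by (intro computable_if decidable_even F' computable_add computable_mult computable_nth
        computable_const) simp
  have last: "\<exists>y b. length y = m \<and> F (Suc m) = y @ [b] \<and> g (Suc m) = of_bool b" for m
  proof -
    obtain y b where "F (Suc m) = y @ [b]"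
      using F[of "replicate (Suc m) True" "Suc m"] by (cases "F (Suc m)" rule: rev_cases) auto
    then show ?thesis
      using F[of "replicate (Suc m) True" "Suc m"] by (auto simp: g_def)
  qed
  have mark: "(g (Suc m) = 1) \<noteq> odd v" if "mark \<phi> B m = Some v" for m v
  proof -
    obtain y b where y: "length y = m" "F (Suc m) = y @ [b]" "g (Suc m) = of_bool b"
      using last by blast
    have "b \<noteq> odd v"
      using last_bit_of_max(1)[of y b v] F[of _ "Suc m"] y that by simp
    then show ?thesis using y(3) by simp
  qed
  have odd: "g (Suc m) = 0" if "odd m" "m div 2 \<notin> B" for m
  proof -
    obtain y b where y: "length y = m" "F (Suc m) = y @ [b]" "g (Suc m) = of_bool b"
      using last by blast
    have "\<not> b"
      using last_bit_of_max(2)[of y b] F[of _ "Suc m"] y that by simp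
    then show ?thesis using y(3) by simp
  qed
  show "PA_complete \<phi> A"
    unfolding PA_complete_def
  proof (intro exI conjI)
    show "recursive_in A (\<lambda>x. g (2 * x + 1))"
      unfolding recursive_in_iff by (rule g)
    show "range (\<lambda>x. g (2 * x + 1)) \<subseteq> {0, 1}"
      by (auto simp: g_def)
    \<comment> \<open>As \<open>g\<close> is 0 or 1, equality would make the last bit equal to the
      parity of the value, which a string of maximal complexity avoids.\<close>
    have "\<phi> x x \<noteq> Some (g (2 * x + 1))" for x
      using mark[of "2 * x" "g (2 * x + 1)"] by (auto simp: mark_def g_def split: if_splits)
    then show "DNR \<phi> (\<lambda>x. g (2 * x + 1))"
      by (simp add: DNR_def)
  qed
  \<comment> \<open>For \<open>x\<close> in \<open>B\<close> the value 0 of \<open>mark\<close>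
    forces the last bit to be 1. For other \<open>x\<close> only the bit 1 is favoured, which forces
    0.\<close>
  have "g (2 * x + 2) = (if x \<in> B then 1 else 0)" for x
  proof (cases "x \<in> B")
    case True
    then show ?thesis
      using mark[of "2 * x + 1" 0] by (simp add: mark_def)
  next
    case False
    then show ?thesis
      using odd[of "2 * x + 1"] by simp
  qed
  then show "B \<le>\<^sub>T A"
    using g[of 2] unfolding turing_le_def recursive_in_iff by simp
qed

lemma max_from_PA:
  assumes \<phi>: "acceptable_numbering \<phi>" and PA: "PA_complete \<phi> A" and B: "B \<le>\<^sub>T A"
  shows "\<exists>F. string_fun_recursive_in A F \<and>
    (\<forall>n x. length x = n \<longrightarrow> length (F n) = n \<and> plain_complexity U (F n) \<ge> plain_complexity U x)"
proof -
  obtain f where "partial_recursive1 f" and f: "\<And>p. map_option str_code (U p) = f (str_code p)"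
    using machine_U by (auto simp: machine_def)
  then obtain T where T: "decidable {} (Suc (Suc 1)) T"
    "\<And>xs v. length xs = 1 \<Longrightarrow> f (xs ! 0) = Some v \<longleftrightarrow> (\<exists>s. T (s # v # xs))"
    using decidable_stages[of 1 "\<lambda>xs. f (xs ! 0)"] unfolding partial_recursive1_iff by blast
  \<comment> \<open>The bound on \<open>c\<close> restricts to programs shorter than
    \<open>a\<close>, so the numbers never enumerated for \<open>a\<close> are the codes of strings
    of complexity at least \<open>a\<close>.\<close>
  define E where "E s a x \<longleftrightarrow> (\<exists>c<2 ^ a - 1. T [s, x, c])" for s a x
  have "decidable {} 3 (\<lambda>xs. \<exists>c<2 ^ (xs ! 1) - 1. (\<lambda>ys. T (map (\<lambda>h. h ys)
      [\<lambda>ys. ys ! 1, \<lambda>ys. ys ! 3, \<lambda>ys. ys ! 0])) (c # xs))"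
  proof (rule decidable_bex)
    show "computable {} 3 (\<lambda>xs. 2 ^ (xs ! 1) - 1)"
      by (intro computable_diff computable_power computable_nth computable_const) simp
    show "decidable {} (Suc 3) (\<lambda>ys. T (map (\<lambda>h. h ys) [\<lambda>ys. ys ! 1, \<lambda>ys. ys ! 3, \<lambda>ys. ys ! 0]))"
      by (rule computable_comp) (use T(1) in \<open>auto intro: computable_nth\<close>)
  qed
  then have "decidable {} 3 (\<lambda>xs. E (xs ! 0) (xs ! 1) (xs ! 2))"
    by (simp add: E_def numeral_3_eq_3 numeral_2_eq_2)
  from PA_choose_of_interval[OF \<phi> PA this] obtain w where
    w: "computable A 3 (\<lambda>xs. w (xs ! 0) (xs ! 1) (xs ! 2))" "\<And>a b k. w a b k \<in> {b..b + k}"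
    "\<And>a b k x. x \<in> {b..b + k} \<Longrightarrow> \<forall>s. \<not> E s a x \<Longrightarrow> \<forall>s. \<not> E s a (w a b k)"
    by blast
  have E: "(\<forall>s. \<not> E s a (str_code x)) \<longleftrightarrow> enat a \<le> plain_complexity U x" for a x
  proof -
    have "f c = Some v \<longleftrightarrow> (\<exists>s. T [s, v, c])" for c v
      using T(2)[of "[c]" v] by simp
    then have "(\<exists>s. E s a (str_code x)) \<longleftrightarrow> (\<exists>c<2 ^ a - 1. f c = Some (str_code x))"
      unfolding E_def by blast
    also have "\<dots> \<longleftrightarrow> (\<exists>p. str_code p < 2 ^ a - 1 \<and> f (str_code p) = Some (str_code x))"
      by (metis str_code_decode)
    also have "\<dots> \<longleftrightarrow> (\<exists>p. length p < a \<and> U p = Some x)"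
    proof -
      have "str_code p < 2 ^ a - 1 \<longleftrightarrow> length p < a" for p
        by (rule str_code_less_iff)
      moreover have "f (str_code p) = Some (str_code x) \<longleftrightarrow> U p = Some x" for p
        unfolding f[symmetric] using bij_is_inj[OF bij_str_code] by (auto simp: inj_eq)
      ultimately show ?thesis by simp
    qed
    also have "\<dots> \<longleftrightarrow> plain_complexity U x < enat a"
      by (simp add: plain_complexity_less_iff)
    finally show ?thesis unfolding not_less[symmetric] by blast
  qed
  \<comment> \<open>The tournament for the threshold \<open>max_complexity n\<close> is held among
    the codes of the strings of length \<open>n\<close>. The oracle computes the threshold by way of
    \<open>B\<close>.\<close>
  define h where "h n = w (max_complexity n) (2 ^ n - 1) (2 ^ n - 1)" for n
  have "computable A k (\<lambda>xs. if f xs \<in> B then 1 else 0)" if "computable A k f" for k f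
    using computable_comp1[OF B[unfolded turing_le_def recursive_in_iff] that] .
  then have B': "decidable A k (\<lambda>xs. f xs \<in> B)" if "computable A k f" for k f
    using that by (simp add: of_bool_def)
  have "computable A 1 (\<lambda>xs. h (xs ! 0))"
    unfolding h_def max_complexity_def
    by (intro computable_comp3[OF w(1)] computable_if decidable_conj decidable_even decidable_less B'
        computable_add computable_diff computable_div computable_power computable_nth computable_const)
      simp_all
  then have "string_fun_recursive_in A (\<lambda>n. inv str_code (h n))"
    by (simp add: string_fun_recursive_in_def recursive_in_iff)
  moreover have "length (inv str_code (h n)) = n" for n
    using w(2)[of "max_complexity n" "2 ^ n - 1" "2 ^ n - 1"] length_eq_iff_str_code[of "inv str_code (h n)" n]
    by (simp add: h_def)
  moreover have "plain_complexity U x \<le> plain_complexity U (inv str_code (h n))" if x: "length x = n" for n x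
  proof (cases n)
    \<comment> \<open>\<open>exists_max_complexity\<close> speaks of positive lengths; at length 0
      there is only one string.\<close>
    case 0
    then have "inv str_code (h n) = x"
      using calculation(2)[of n] x by simp
    then show ?thesis by simp
  next
    case (Suc m)
    then obtain z where z: "length z = n" "enat (max_complexity n) \<le> plain_complexity U z"
      using exists_max_complexity[of m] by blast
    have "str_code z \<in> {2 ^ n - 1..2 ^ n - 1 + (2 ^ n - 1)}"
      using z(1) by (simp add: length_eq_iff_str_code)
    then have "\<forall>s. \<not> E s (max_complexity n) (str_code (inv str_code (h n)))"
      using w(3) z(2) unfolding h_def str_code_decode E[symmetric] by blast
    then have "enat (max_complexity n) \<le> plain_complexity U (inv str_code (h n))"
      unfolding E .
    with complexity_le_max[of x] show ?thesis
      unfolding x by (rule order_trans)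
  qed
  ultimately show ?thesis
    by (intro exI[of _ "\<lambda>n. inv str_code (h n)"]) blast
qed

end

theorem theorem4p2:
  fixes \<phi> :: "nat \<Rightarrow> nat \<rightharpoonup> nat" and B :: "nat set"
  assumes "acceptable_numbering \<phi>"
    and "recursively_enumerable B"
  shows "\<exists>U. universal_machine U \<and>
           (\<forall>A :: nat set.
              (PA_complete \<phi> A \<and> B \<le>\<^sub>T A) \<longleftrightarrow>
              (\<exists>F :: nat \<Rightarrow> bool list. string_fun_recursive_in A F \<and>
                 (\<forall>n x. length x = n \<longrightarrow>
                    length (F n) = n \<and>
                    plain_complexity U (F n) \<ge> plain_complexity U x)))"
proof -
  obtain U where "marking_machine \<phi> B U"
    using marking_machine_exists[OF assms] by blast
  then interpret marking_machine \<phi> B U .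
  show ?thesis
  proof (intro exI[of _ U] conjI allI iffI universal_U[OF assms(1)])
    fix A
    assume "PA_complete \<phi> A \<and> B \<le>\<^sub>T A"
    then show "\<exists>F. string_fun_recursive_in A F \<and> (\<forall>n x. length x = n \<longrightarrow>
        length (F n) = n \<and> plain_complexity U (F n) \<ge> plain_complexity U x)"
      using max_from_PA[OF assms(1)] by blast
  next
    fix A
    assume "\<exists>F. string_fun_recursive_in A F \<and> (\<forall>n x. length x = n \<longrightarrow>
        length (F n) = n \<and> plain_complexity U (F n) \<ge> plain_complexity U x)"
    then obtain F where F: "string_fun_recursive_in A F"
      "\<And>n x. length x = n \<Longrightarrow> length (F n) = n \<and> plain_complexity U (F n) \<ge> plain_complexity U x"
      by blast
    show "PA_complete \<phi> A" and "B \<le>\<^sub>T A"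
      using PA_from_max[OF F] by blast+
  qed
qed

end
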